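(* Let $n\ge 5$ and consider all bicyclic graphs on $n$ vertices. Then $B_n(n-1,3)$ is the unique such graph with the minimum sum--connectivity index, which equals $\frac{1}{\sqrt{n+2}}+\frac{n-4}{\sqrt{n}}+\frac{2}{\sqrt{n+1}}+\frac{2}{\sqrt{5}}$. Moreover, the unique graph with the second minimum sum--connectivity index is: for $n=5$, the graph obtained by attaching one pendent vertex to a vertex of degree two of $K_4-e$, with index $\frac{3}{\sqrt{6}}+\frac{2}{\sqrt{5}}+\frac{1}{2}$; for $n=6,7$, the graph $B_n(n-2,4)$, with index $\frac{1}{\sqrt{n+2}}+\frac{2}{\sqrt{n}}+\frac{n-5}{\sqrt{n-1}}+\frac{2}{\sqrt{6}}+\frac{1}{\sqrt{5}}$; for $n\ge 8$, the graph $B_{n,3}$, with index $\frac{4}{\sqrt{n+1}}+\frac{n-5}{\sqrt{n}}+1$.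
   Context: All graphs are simple. For a graph $G$, $d_G(u)$ is the degree of $u$. The sum--connectivity index is $\chi(G)=\sum_{uv\in E(G)}\frac{1}{\sqrt{d_G(u)+d_G(v)}}$. A bicyclic graph is a connected graph with $n$ vertices and $n+1$ edges. $K_4-e$ denotes the unique bicyclic graph on 4 vertices (two vertices of degree 3, two of degree 2). For $a\ge b\ge 3$ with $a+b=n+2$, $B_n(a,b)$ is obtained from $K_4-e$ by attaching $a-3$ pendent vertices to one vertex of degree three and $b-3$ pendent vertices to the other vertex of degree three. $B_{n,3}$ is the graph obtained by identifying one vertex of each of two triangles (common vertex $c$) and attaching $n-5$ pendent vertices to $c$. *)

theory Defs
  imports Complex_Main "Graph_Theory.Graph_Theory"
begin

text \<open>
  A simple graph is a \<^locale>\<open>pair_graph\<close>: a finite symmetric loop-free relation on a finite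
  vertex set, so every undirected edge \<open>uv\<close> is present as the two arcs \<open>(u,v)\<close> and \<open>(v,u)\<close>.
  Edges are therefore counted and summed over as two-element vertex sets, and the degree of \<open>u\<close>
  is its out-degree.
\<close>

definition uedges :: "'a pair_pre_digraph \<Rightarrow> 'a set set" where
  "uedges G = (\<lambda>(u, v). {u, v}) ` parcs G"

definition degree :: "'a pair_pre_digraph \<Rightarrow> 'a \<Rightarrow> nat" where
  "degree G u = out_degree (with_proj G) u"

text \<open>For an edge \<open>e = {u,v}\<close> with \<open>u \<noteq> v\<close> the inner sum is the sum of the degrees of \<open>u\<close> and \<open>v\<close>.\<close>

definition sum_connectivity :: "'a pair_pre_digraph \<Rightarrow> real" where
  "sum_connectivity G = (\<Sum>e\<in>uedges G. 1 / sqrt (real (\<Sum>u\<in>e. degree G u)))"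

text \<open>\<open>connected\<close> has to be qualified: the unqualified name may denote the topological notion.\<close>

definition bicyclic :: "nat \<Rightarrow> 'a pair_pre_digraph \<Rightarrow> bool" where
  "bicyclic n G \<longleftrightarrow> pair_graph G \<and> Digraph_Component.connected (with_proj G) \<and>
     card (pverts G) = n \<and> card (uedges G) = n + 1"

definition graph_iso :: "'a pair_pre_digraph \<Rightarrow> 'b pair_pre_digraph \<Rightarrow> bool"  (infix \<open>\<simeq>\<^sub>g\<close> 50) where
  "G \<simeq>\<^sub>g H \<longleftrightarrow> digraph_iso (with_proj G) (with_proj H)"

definition ugraph :: "'a set \<Rightarrow> 'a rel \<Rightarrow> 'a pair_pre_digraph" where
  "ugraph V R = \<lparr>pverts = V, parcs = R \<union> R\<inverse>\<rparr>"

definition attach_pendents :: "nat pair_pre_digraph \<Rightarrow> nat \<Rightarrow> nat \<Rightarrow> nat pair_pre_digraph" where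
  "attach_pendents G v k =
     (let m = Suc (Max (pverts G)); N = {m..<m + k}
      in ugraph (pverts G \<union> N) (parcs G \<union> {v} \<times> N))"

text \<open>Vertices 0 and 1 have degree three, vertices 2 and 3 have degree two.\<close>

definition K4_minus_e :: "nat pair_pre_digraph" where
  "K4_minus_e = ugraph {0, 1, 2, 3} {(0, 1), (0, 2), (0, 3), (1, 2), (1, 3)}"

text \<open>The number of vertices is \<open>n = a + b - 2\<close>; intended for \<open>a \<ge> b \<ge> 3\<close>.\<close>

definition B_graph :: "nat \<Rightarrow> nat \<Rightarrow> nat pair_pre_digraph" where
  "B_graph a b = attach_pendents (attach_pendents K4_minus_e 0 (a - 3)) 1 (b - 3)"

text \<open>Two triangles identified in the vertex 0.\<close>

definition two_triangles :: "nat pair_pre_digraph" where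
  "two_triangles = ugraph {0, 1, 2, 3, 4} {(0, 1), (0, 2), (1, 2), (0, 3), (0, 4), (3, 4)}"

definition B3_graph :: "nat \<Rightarrow> nat pair_pre_digraph" where
  "B3_graph n = attach_pendents two_triangles 0 (n - 5)"

end

theory Submission
  imports Defs
begin

text \<open>
  Let \<open>c\<close> be a vertex of maximum degree \<open>D\<close> and let \<open>k = n - 1 - D\<close> be the number of its
  non-neighbours, so that exactly \<open>k + 2\<close> edges avoid \<open>c\<close>. If \<open>k = 0\<close>, the two edges avoiding \<open>c\<close>
  either share a vertex, which gives \<open>B_n(n-1,3)\<close>, or are disjoint, which gives \<open>B_{n,3}\<close>.

  For \<open>k \<ge> 1\<close> call the degree sum of an edge its weight; it is one more than the number of edges
  meeting it. Hence edges avoiding \<open>c\<close> have weight at most \<open>k + 5\<close>, and the edges meeting a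
  non-neighbour of \<open>c\<close>, of which connectivity provides at least \<open>k\<close>, have weight at most \<open>k + 4\<close>.
  The edges at \<open>c\<close> have total weight at most \<open>D (D + 1) + k + 4\<close>, and convexity of
  \<open>1 / sqrt w\<close> bounds their contribution. This beats \<open>B_{n,3}\<close> when \<open>2 k + 4 \<le> n\<close> and \<open>n \<ge> 8\<close>. When
  \<open>D\<close> is smaller, the total weight of all edges, which is the sum of the squared degrees, is so
  small that Jensen's inequality applied to all edges suffices. For \<open>n \<le> 7\<close> the same estimates
  leave only few configurations, which are identified by hand.
\<close>

section \<open>Graphs as edge sets\<close>

text \<open>Degree, weight and index are restated for a bare set of edges, so that the combinatorial
  argument never has to handle arcs in both directions. \<open>sum_connectivity_eq_chi\<close> is
  the bridge back.\<close>

definition deg :: "'a set set \<Rightarrow> 'a \<Rightarrow> nat" where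
  "deg E v = card {e \<in> E. v \<in> e}"

definition weight :: "'a set set \<Rightarrow> 'a set \<Rightarrow> nat" where
  "weight E e = (\<Sum>u\<in>e. deg E u)"

definition chi :: "'a set set \<Rightarrow> real" where
  "chi E = (\<Sum>e\<in>E. 1 / sqrt (real (weight E e)))"

lemma parcs_iff_uedges:
  assumes "pair_graph G"
  shows "(u, v) \<in> parcs G \<longleftrightarrow> {u, v} \<in> uedges G"
proof -
  interpret pair_graph G by fact
  show ?thesis
    by (auto simp: uedges_def doubleton_eq_iff image_iff intro: arcs_symmetric)
qed

lemma pair_graph_finite: "pair_graph G \<Longrightarrow> finite (pverts G)"
  by (simp add: pair_graph_def pair_digraph_def pair_fin_digraph.pair_finite_verts)

lemma uedgesE:
  assumes "pair_graph G" "e \<in> uedges G"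
  obtains u v where "e = {u, v}" "u \<noteq> v" "u \<in> pverts G" "v \<in> pverts G"
proof -
  interpret pair_graph G by fact
  from assms(2) obtain u v where "(u, v) \<in> parcs G" "e = {u, v}"
    by (auto simp: uedges_def)
  moreover from this have "u \<noteq> v" "u \<in> pverts G" "v \<in> pverts G"
    using no_loops' in_arcsD1 in_arcsD2 by auto
  ultimately show ?thesis using that by blast
qed

text \<open>An arc starting at \<open>u\<close> is determined by its other end, so forgetting the
  direction is injective on these arcs; symmetry makes every edge at \<open>u\<close> arise this
  way.\<close>

lemma degree_eq_deg:
  assumes "pair_graph G"
  shows "degree G u = deg (uedges G) u"
proof -
  have "{e \<in> uedges G. u \<in> e} = (\<lambda>(u, v). {u, v}) ` {a \<in> parcs G. fst a = u}"
  proof (intro equalityI subsetI)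
    fix e assume e: "e \<in> {e \<in> uedges G. u \<in> e}"
    then obtain x y where xy: "e = {x, y}" using uedgesE[OF assms] by blast
    then obtain z where "e = {u, z}" using e by auto
    then show "e \<in> (\<lambda>(u, v). {u, v}) ` {a \<in> parcs G. fst a = u}"
      using e parcs_iff_uedges[OF assms, of u z] by (auto simp: image_iff)
  qed (auto simp: uedges_def image_iff)
  moreover have "inj_on (\<lambda>(u, v). {u, v}) {a \<in> parcs G. fst a = u}"
    by (auto simp: inj_on_def doubleton_eq_iff)
  ultimately show ?thesis
    by (simp add: degree_def out_degree_def out_arcs_def deg_def card_image)
qed

lemma sum_connectivity_eq_chi:
  "pair_graph G \<Longrightarrow> sum_connectivity G = chi (uedges G)"
  by (simp add: sum_connectivity_def chi_def weight_def degree_eq_deg)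

text \<open>Relabelling that is injective on the covered vertices preserves incidences, hence
  degrees and weights edge by edge. This makes the index an isomorphism invariant.\<close>

lemma chi_image:
  assumes inj: "inj_on f (\<Union>E)"
  shows "chi ((`) f ` E) = chi E"
proof -
  have injE: "inj_on ((`) f) E"
    using inj by (intro inj_onI) (metis Union_upper inj_on_image_eq_iff)
  have deg: "deg ((`) f ` E) (f v) = deg E v" if "v \<in> \<Union>E" for v
  proof -
    have "f v \<in> f ` e \<longleftrightarrow> v \<in> e" if "e \<in> E" for e
      using inj that \<open>v \<in> \<Union>E\<close> by (meson Union_upper inj_on_image_mem_iff)
    then have "{e \<in> (`) f ` E. f v \<in> e} = (`) f ` {e \<in> E. v \<in> e}" by auto
    then show ?thesis
      using injE by (simp add: deg_def card_image inj_on_subset)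
  qed
  have "weight ((`) f ` E) (f ` e) = weight E e" if "e \<in> E" for e
  proof -
    have "inj_on f e" using inj that by (meson Union_upper inj_on_subset)
    then have "weight ((`) f ` E) (f ` e) = (\<Sum>v\<in>e. deg ((`) f ` E) (f v))"
      unfolding weight_def by (subst sum.reindex) auto
    also have "\<dots> = weight E e"
      unfolding weight_def using that deg by (intro sum.cong) auto
    finally show ?thesis .
  qed
  then show ?thesis
    unfolding chi_def by (subst sum.reindex[OF injE]) auto
qed

lemma graph_iso_uedgesE:
  assumes "G \<simeq>\<^sub>g H"
  obtains f where "inj_on f (pverts G)" "(`) f ` uedges G = uedges H"
proof -
  from assms obtain h where h: "pre_digraph.digraph_isomorphism (with_proj G) h"
    and H: "with_proj H = app_iso h (with_proj G)"
    by (auto simp: graph_iso_def digraph_iso_def)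
  let ?f = "iso_verts h"
  from H have "iso_tail h = fst" "iso_head h = snd" and parcs: "parcs H = iso_arcs h ` parcs G"
    by (auto simp: app_iso_def with_proj_def)
  \<comment> \<open>The arc map is a separate component of a digraph isomorphism; compatibility with
    tails and heads forces it to act on pairs through the vertex map.\<close>
  with h have arc: "iso_arcs h a = (?f (fst a), ?f (snd a))" if "a \<in> parcs G" for a
    using that by (simp add: pre_digraph.digraph_isomorphism_def prod_eq_iff)
  have "uedges H = (\<lambda>a. {?f (fst a), ?f (snd a)}) ` parcs G"
    unfolding uedges_def parcs image_image using arc by (intro image_cong) auto
  also have "\<dots> = (`) ?f ` uedges G"
    unfolding uedges_def image_image by (intro image_cong) auto
  finally have "(`) ?f ` uedges G = uedges H" ..
  with that show ?thesis using h by (auto simp: pre_digraph.digraph_isomorphism_def)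
qed

lemma graph_iso_imp_sum_connectivity_eq:
  assumes G: "pair_graph G" and H: "pair_graph H" and "G \<simeq>\<^sub>g H"
  shows "sum_connectivity G = sum_connectivity H"
proof -
  obtain f where f: "inj_on f (pverts G)" "(`) f ` uedges G = uedges H"
    using graph_iso_uedgesE[OF assms(3)] .
  have "\<Union>(uedges G) \<subseteq> pverts G"
    using uedgesE[OF G] by blast
  then show ?thesis
    using chi_image[of f "uedges G"] f G H
    by (simp add: sum_connectivity_eq_chi inj_on_subset)
qed

lemma graph_isoI:
  assumes G: "pair_graph G" and H: "pair_graph H"
    and f: "bij_betw f (pverts G) (pverts H)" and E: "(`) f ` uedges G = uedges H"
  shows "G \<simeq>\<^sub>g H"
proof -
  interpret G: pair_graph G by fact
  interpret H: pair_graph H by fact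
  \<comment> \<open>An isomorphism record also carries an arc map and the projections of the image
    graph. Arcs are pairs here, so \<open>map_prod f f\<close>, \<open>snd\<close> and
    \<open>fst\<close> are the only sensible choices.\<close>
  let ?h = "\<lparr>iso_verts = f, iso_arcs = map_prod f f, iso_head = snd, iso_tail = fst\<rparr>"
  have inj: "inj_on f (pverts G)" using f by (simp add: bij_betw_def)
  have "inj_on (map_prod f f) (pverts G \<times> pverts G)"
    using inj by (rule map_prod_inj_on) (rule inj)
  moreover have "parcs G \<subseteq> pverts G \<times> pverts G"
    using G.in_arcsD1 G.in_arcsD2 by auto
  ultimately have injE: "inj_on (map_prod f f) (parcs G)"
    by (rule inj_on_subset)
  have parcs: "parcs H = map_prod f f ` parcs G"
  proof (intro equalityI subsetI)
    fix a assume a: "a \<in> parcs H"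
    obtain x y where xy: "a = (x, y)" by force
    with a have "{x, y} \<in> (`) f ` uedges G" using parcs_iff_uedges[OF H] E by auto
    then obtain e where e: "e \<in> uedges G" "{x, y} = f ` e" by auto
    obtain u v where "e = {u, v}" using uedgesE[OF G e(1)] by metis
    with e have uv: "(u, v) \<in> parcs G" and "x = f u \<and> y = f v \<or> x = f v \<and> y = f u"
      using parcs_iff_uedges[OF G, of u v] by (simp_all add: doubleton_eq_iff)
    moreover from uv have "(v, u) \<in> parcs G" by (rule G.arcs_symmetric)
    ultimately have "(x, y) = map_prod f f (u, v) \<or> (x, y) = map_prod f f (v, u)" by auto
    then show "a \<in> map_prod f f ` parcs G"
      unfolding xy using uv \<open>(v, u) \<in> parcs G\<close> by blast
  next
    fix a assume "a \<in> map_prod f f ` parcs G"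
    then obtain u v where "a = (f u, f v)" "{u, v} \<in> uedges G"
      using parcs_iff_uedges[OF G] by auto
    moreover from this have "f ` {u, v} \<in> uedges H"
      unfolding E[symmetric] by (intro imageI)
    ultimately show "a \<in> parcs H" using parcs_iff_uedges[OF H] by simp
  qed
  have "pre_digraph.digraph_isomorphism (with_proj G) ?h"
    using inj injE G.wf_digraph_axioms
    by (auto simp: pre_digraph.digraph_isomorphism_def)
  moreover have "with_proj H = app_iso ?h (with_proj G)"
    using f parcs by (simp add: app_iso_def with_proj_def bij_betw_def)
  ultimately show ?thesis
    unfolding graph_iso_def digraph_iso_def by blast
qed

text \<open>Connectivity enters as \<open>cut\<close>: some edge leaves every proper non-empty set of vertices.\<close>

locale bicyclic_edges =
  fixes V :: "'a set" and E :: "'a set set" and n :: nat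
  assumes finite_V: "finite V" and card_V: "card V = n" and card_E: "card E = n + 1"
    and edgeE: "e \<in> E \<Longrightarrow> \<exists>u v. e = {u, v} \<and> u \<noteq> v \<and> u \<in> V \<and> v \<in> V"
    and cut: "A \<subseteq> V \<Longrightarrow> A \<noteq> {} \<Longrightarrow> A \<noteq> V \<Longrightarrow> \<exists>a\<in>A. \<exists>b\<in>V - A. {a, b} \<in> E"

text \<open>Walks can be reversed in a symmetric graph, so reaching everything from one vertex joins
  any two vertices through \<open>c\<close>.\<close>

lemma pair_graph_connectedI:
  assumes G: "pair_graph G" and c: "c \<in> pverts G"
    and reach: "\<And>v. v \<in> pverts G \<Longrightarrow> c \<rightarrow>\<^sup>*\<^bsub>with_proj G\<^esub> v"
  shows "Digraph_Component.connected (with_proj G)"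
proof -
  interpret pair_graph G by fact
  have "u \<rightarrow>\<^sup>*\<^bsub>with_proj G\<^esub> v" if "u \<in> pverts G" "v \<in> pverts G" for u v
    using symmetric_reachable[OF sym_arcs reach[OF that(1)]] reach[OF that(2)] reachable_trans
    by blast
  then show ?thesis
    using c reachable_mk_symmetric_eq[OF sym_arcs]
    by (auto simp: Digraph_Component.connected_def strongly_connected_def)
qed

lemma bicyclic_imp_bicyclic_edges:
  assumes "bicyclic n G" "n \<ge> 1"
  shows "bicyclic_edges (pverts G) (uedges G) n"
proof
  from assms have G: "pair_graph G" and conn: "Digraph_Component.connected (with_proj G)"
    and c: "card (pverts G) = n" "card (uedges G) = n + 1"
    by (auto simp: bicyclic_def)
  interpret pair_graph G by fact
  show "finite (pverts G)" by (rule pair_finite_verts)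
  show "card (pverts G) = n" "card (uedges G) = n + 1" by fact+
  show "\<exists>u v. e = {u, v} \<and> u \<noteq> v \<and> u \<in> pverts G \<and> v \<in> pverts G" if "e \<in> uedges G" for e
    using uedgesE[OF G that] by metis
  fix A assume A: "A \<subseteq> pverts G" "A \<noteq> {}" "A \<noteq> pverts G"
  then obtain x y where xy: "x \<in> A" "y \<in> pverts G" "y \<notin> A" by blast
  have "strongly_connected (with_proj G)"
    using symmetric_connected_imp_strongly_connected[OF sym_arcs conn] .
  then have "x \<rightarrow>\<^sup>*\<^bsub>with_proj G\<^esub> y"
    using xy A by (auto simp: strongly_connected_def)
  \<comment> \<open>Induction along a walk from \<open>x\<close>: either the current vertex still
    lies in \<open>A\<close>, or some earlier arc has already left \<open>A\<close>.\<close>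
  then have "y \<in> A \<or> (\<exists>a\<in>A. \<exists>b\<in>pverts G - A. (a, b) \<in> parcs G)"
  proof (induct rule: reachable_induct)
    case base
    then show ?case using xy by simp
  next
    case (step u v)
    then show ?case using in_arcsD2 by auto
  qed
  then show "\<exists>a\<in>A. \<exists>b\<in>pverts G - A. {a, b} \<in> uedges G"
    using xy parcs_iff_uedges[OF G] by blast
qed

text \<open>In each extremal graph the vertices outside a short list are interchangeable, so an
  isomorphism only has to be prescribed on that list. The complements have equal size and may be
  matched arbitrarily.\<close>

lemma bij_betw_extend_lists:
  assumes "finite V" "finite W" "card V = card W"
    and "distinct xs" "distinct ys" "set xs \<subseteq> V" "set ys \<subseteq> W" "length xs = length ys"
  shows "\<exists>f. bij_betw f V W \<and> map f xs = ys"
proof -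
  have "card (V - set xs) = card (W - set ys)"
    using assms by (simp add: card_Diff_subset distinct_card)
  then obtain g where g: "bij_betw g (V - set xs) (W - set ys)"
    using assms by (meson finite_Diff finite_same_card_bij)
  define h where "h = (\<lambda>v. the (map_of (zip xs ys) v))"
  have hmap: "map h xs = ys"
    using assms by (intro nth_equalityI) (auto simp: h_def map_of_zip_nth)
  then have "bij_betw h (set xs) (set ys)"
    using assms by (metis bij_betw_def distinct_map image_set)
  from bij_betw_disjoint_Un[OF this g]
  have "bij_betw (\<lambda>v. if v \<in> set xs then h v else g v) (set xs \<union> (V - set xs)) (set ys \<union> (W - set ys))"
    by auto
  moreover have "set xs \<union> (V - set xs) = V" "set ys \<union> (W - set ys) = W"
    using assms by auto
  moreover have "map (\<lambda>v. if v \<in> set xs then h v else g v) xs = ys"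
    using hmap by auto
  ultimately show ?thesis by metis
qed

section \<open>Stars, degrees of explicit edge sets, double counting\<close>

definition star :: "'a set \<Rightarrow> 'a \<Rightarrow> 'a set set" where
  "star A c = (\<lambda>v. {c, v}) ` A"

lemma inj_on_pair: "inj_on (\<lambda>v. {c, v}) A"
  by (auto simp: inj_on_def doubleton_eq_iff)

lemma finite_star: "finite A \<Longrightarrow> finite (star A c)"
  by (simp add: star_def)

lemma card_star: "card (star A c) = card A"
  by (simp add: star_def card_image inj_on_pair)

lemma star_empty: "star {} c = {}"
  by (simp add: star_def)

lemma star_insert: "star (insert v A) c = insert {c, v} (star A c)"
  by (simp add: star_def)

lemma doubleton_in_star: "{u, v} \<in> star A c \<longleftrightarrow> u = c \<and> v \<in> A \<or> v = c \<and> u \<in> A"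
  by (auto simp: star_def doubleton_eq_iff)

lemma image_star: "(`) f ` star A c = star (f ` A) (f c)"
  by (simp add: star_def image_image)

lemma deg_insert:
  assumes "finite E" "e \<notin> E"
  shows "deg (insert e E) v = deg E v + of_bool (v \<in> e)"
proof -
  have "{e' \<in> insert e E. v \<in> e'} = (if v \<in> e then insert e {e' \<in> E. v \<in> e'} else {e' \<in> E. v \<in> e'})"
    by auto
  then show ?thesis using assms by (simp add: deg_def)
qed

lemma deg_empty: "deg {} v = 0"
  by (simp add: deg_def)

lemma deg_star:
  assumes "c \<notin> A"
  shows "deg (star A c) v = (if v = c then card A else of_bool (v \<in> A))"
proof (cases "v = c")
  case True
  then have "{e \<in> star A c. v \<in> e} = star A c" by (auto simp: star_def)
  then show ?thesis using True by (simp add: deg_def card_star)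
next
  case False
  then have "{e \<in> star A c. v \<in> e} = (if v \<in> A then {{c, v}} else {})"
    by (auto simp: star_def)
  then show ?thesis using False by (simp add: deg_def)
qed

lemma weight_doubleton: "u \<noteq> v \<Longrightarrow> weight E {u, v} = deg E u + deg E v"
  by (simp add: weight_def)

lemma sum_star: "(\<Sum>e\<in>star A c. f e) = (\<Sum>v\<in>A. f {c, v})"
  unfolding star_def by (subst sum.reindex[OF inj_on_pair]) simp

text \<open>Serves the sums over stars, where all but a few neighbours of the centre are leaves and
  contribute the same term.\<close>

lemma sum_except:
  fixes g :: "'a \<Rightarrow> real"
  assumes "finite A" "B \<subseteq> A" "\<And>v. v \<in> A - B \<Longrightarrow> g v = r"
  shows "sum g A = sum g B + (real (card A) - real (card B)) * r"
proof -
  have "sum g A = sum g (A - B) + sum g B"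
    using assms by (intro sum.subset_diff) auto
  also have "sum g (A - B) = real (card (A - B)) * r" using assms(3) by simp
  also have "real (card (A - B)) = real (card A) - real (card B)"
    using assms by (simp add: card_Diff_subset card_mono finite_subset of_nat_diff)
  finally show ?thesis by simp
qed

lemma sum_deg_eq_sum_card:
  assumes "finite E" "finite A"
  shows "(\<Sum>v\<in>A. deg E v) = (\<Sum>e\<in>E. card (e \<inter> A))"
proof -
  have "(\<Sum>v\<in>A. deg E v) = (\<Sum>v\<in>A. \<Sum>e\<in>E. of_bool (v \<in> e))"
    using assms by (simp add: deg_def of_bool_def sum.If_cases Int_def)
  also have "\<dots> = (\<Sum>e\<in>E. \<Sum>v\<in>A. of_bool (v \<in> e))" by (rule sum.swap)
  also have "\<dots> = (\<Sum>e\<in>E. card (e \<inter> A))"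
    using assms by (simp add: of_bool_def sum.If_cases Int_def conj_commute)
  finally show ?thesis .
qed

section \<open>Convexity and counting bounds\<close>

text \<open>The right side is the tangent at \<open>t\<close> of the convex function 1 / sqrt. With
  \<open>a\<close>, \<open>b\<close> the roots of \<open>w\<close>, \<open>t\<close>, the difference
  factors with the square of \<open>a - b\<close>.\<close>

lemma inverse_sqrt_tangent:
  fixes w t :: real
  assumes "w > 0" "t > 0"
  shows "1 / sqrt w \<ge> 3 / (2 * sqrt t) - w / (2 * t * sqrt t)"
proof -
  define a b where "a = sqrt w" and "b = sqrt t"
  have ab: "a > 0" "b > 0" "w = a\<^sup>2" "t = b\<^sup>2" using assms by (auto simp: a_def b_def)
  have "1 / a - (3 / (2 * b) - a\<^sup>2 / (2 * b\<^sup>2 * b)) = (a - b)\<^sup>2 * (a + 2 * b) / (2 * a * b ^ 3)"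
    using ab by (simp add: field_simps power2_eq_square power3_eq_cube)
  also have "\<dots> \<ge> 0" using ab by simp
  finally show ?thesis
    using ab by (simp add: real_sqrt_abs)
qed

text \<open>The tangent inequality is summed over \<open>A\<close>. Its slope is negative, so an
  upper bound \<open>W\<close> on the total weight suffices, and \<open>t\<close> may be any
  convenient point rather than the mean.\<close>

lemma sum_inverse_sqrt_ge:
  fixes w :: "'b \<Rightarrow> nat" and t W :: real
  assumes "t > 0" "\<And>e. e \<in> A \<Longrightarrow> w e > 0" "real (\<Sum>e\<in>A. w e) \<le> W"
  shows "(\<Sum>e\<in>A. 1 / sqrt (real (w e))) \<ge> 3 * real (card A) / (2 * sqrt t) - W / (2 * t * sqrt t)"
proof -
  have "3 * real (card A) / (2 * sqrt t) - W / (2 * t * sqrt t)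
      \<le> 3 * real (card A) / (2 * sqrt t) - real (\<Sum>e\<in>A. w e) / (2 * t * sqrt t)"
    using assms by (intro diff_left_mono divide_right_mono) auto
  also have "\<dots> = (\<Sum>e\<in>A. 3 / (2 * sqrt t) - real (w e) / (2 * t * sqrt t))"
    by (simp add: sum_subtractf sum_divide_distrib)
  also have "\<dots> \<le> (\<Sum>e\<in>A. 1 / sqrt (real (w e)))"
    using assms by (intro sum_mono inverse_sqrt_tangent) auto
  finally show ?thesis .
qed

lemma jensen_inverse_sqrt:
  fixes w :: "'b \<Rightarrow> nat" and t :: real
  assumes "t > 0" "\<And>e. e \<in> A \<Longrightarrow> w e > 0" "real (\<Sum>e\<in>A. w e) \<le> t * real (card A)"
  shows "(\<Sum>e\<in>A. 1 / sqrt (real (w e))) \<ge> real (card A) / sqrt t"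
proof -
  have "3 * real (card A) / (2 * sqrt t) - t * real (card A) / (2 * t * sqrt t) = real (card A) / sqrt t"
    using assms(1) by (simp add: field_simps)
  then show ?thesis using sum_inverse_sqrt_ge[OF assms] by simp
qed

context bicyclic_edges
begin

text \<open>An infinite set has cardinality 0 by convention, whereas \<open>card_E\<close> gives a
  positive value.\<close>

lemma finite_E: "finite E"
  using card_E by (metis add_gr_0 card_gt_0_iff less_numeral_extra(1))

lemma edge_subset: "e \<in> E \<Longrightarrow> e \<subseteq> V"
  using edgeE by blast

lemma card_edge: "e \<in> E \<Longrightarrow> card e = 2"
  using edgeE by fastforce

lemma finite_edge: "e \<in> E \<Longrightarrow> finite e"
  using edge_subset finite_V finite_subset by blast

lemma deg_pos:
  assumes "n \<ge> 2" "v \<in> V"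
  shows "deg E v \<ge> 1"
proof -
  have "{v} \<noteq> V" using card_V assms by auto
  then obtain b where "{v, b} \<in> E" using cut[of "{v}"] assms by auto
  then have "{e \<in> E. v \<in> e} \<noteq> {}" by auto
  then show ?thesis
    unfolding deg_def using finite_E by (simp add: Suc_le_eq card_gt_0_iff)
qed

lemma sum_deg: "(\<Sum>v\<in>V. deg E v) = 2 * (n + 1)"
proof -
  have "(\<Sum>v\<in>V. deg E v) = (\<Sum>e\<in>E. card (e \<inter> V))"
    by (rule sum_deg_eq_sum_card[OF finite_E finite_V])
  also have "\<dots> = (\<Sum>e\<in>E. 2)"
    using edge_subset card_edge by (intro sum.cong) (auto simp: Int_absorb2)
  finally show ?thesis using card_E by simp
qed

text \<open>Double counting: a vertex contributes its degree once for each of its edges. This turns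
  the total weight into a quantity governed by the degree sequence.\<close>

lemma sum_weight: "(\<Sum>e\<in>E. weight E e) = (\<Sum>v\<in>V. (deg E v)\<^sup>2)"
proof -
  have "(\<Sum>e\<in>E. weight E e) = (\<Sum>e\<in>E. \<Sum>v\<in>V. if v \<in> e then deg E v else 0)"
  proof (rule sum.cong)
    fix e assume "e \<in> E"
    then have "V \<inter> e = e" using edge_subset by blast
    then show "weight E e = (\<Sum>v\<in>V. if v \<in> e then deg E v else 0)"
      using finite_V by (simp add: weight_def sum.If_cases)
  qed simp
  also have "\<dots> = (\<Sum>v\<in>V. \<Sum>e\<in>E. if v \<in> e then deg E v else 0)" by (rule sum.swap)
  also have "\<dots> = (\<Sum>v\<in>V. (deg E v)\<^sup>2)"
    using finite_E by (simp add: sum.If_cases deg_def Int_def power2_eq_square)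
  finally show ?thesis .
qed

text \<open>The edges through one end and those through the other have only \<open>e\<close> in
  common, so inclusion-exclusion counts \<open>e\<close> twice and every other edge meeting
  \<open>e\<close> once.\<close>

lemma weight_edge:
  assumes "e \<in> E"
  shows "weight E e = card {e' \<in> E. e' \<inter> e \<noteq> {}} + 1"
proof -
  obtain u v where uv: "e = {u, v}" "u \<noteq> v" using edgeE[OF assms] by blast
  let ?A = "{e' \<in> E. u \<in> e'}" and ?B = "{e' \<in> E. v \<in> e'}"
  have "?A \<inter> ?B = {e}"
  proof -
    have "e' = e" if "e' \<in> E" "u \<in> e'" "v \<in> e'" for e'
    proof -
      have "e \<subseteq> e'" using that uv by simp
      moreover have "card e = card e'" using that assms by (simp add: card_edge)
      ultimately show ?thesis using finite_edge[OF that(1)] card_subset_eq by metis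
    qed
    moreover have "e \<in> ?A \<inter> ?B" using assms uv by simp
    ultimately show ?thesis by blast
  qed
  moreover have "?A \<union> ?B = {e' \<in> E. e' \<inter> e \<noteq> {}}" using uv by auto
  moreover have "card ?A + card ?B = card (?A \<union> ?B) + card (?A \<inter> ?B)"
    using finite_E by (intro card_Un_Int) auto
  ultimately show ?thesis using uv by (simp add: weight_def deg_def)
qed

lemma weight_pos: "e \<in> E \<Longrightarrow> weight E e > 0"
  by (simp add: weight_edge)

text \<open>By induction on the size of \<open>A\<close>: some edge joins a vertex \<open>a\<close>
  of \<open>A\<close> to a vertex outside. It meets \<open>A\<close> only in \<open>a\<close>, so
  removing \<open>a\<close> from \<open>A\<close> loses at least this edge.\<close>

lemma card_touching_ge:
  assumes "A \<subseteq> V" "A \<noteq> V"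
  shows "card A \<le> card {e \<in> E. e \<inter> A \<noteq> {}}"
proof -
  from assms have "finite A" using finite_V finite_subset by blast
  then show ?thesis using assms
  proof (induct "card A" arbitrary: A)
    case 0
    then show ?case by simp
  next
    case (Suc m)
    then obtain a b where ab: "a \<in> A" "b \<in> V - A" "{a, b} \<in> E"
      using cut[of A] by fastforce
    have "m = card (A - {a})" using Suc ab by simp
    then have "m \<le> card {e \<in> E. e \<inter> (A - {a}) \<noteq> {}}"
      using Suc.hyps(1)[of "A - {a}"] Suc.prems ab by auto
    also have "\<dots> < card {e \<in> E. e \<inter> A \<noteq> {}}"
    proof (rule psubset_card_mono)
      show "{e \<in> E. e \<inter> (A - {a}) \<noteq> {}} \<subset> {e \<in> E. e \<inter> A \<noteq> {}}"
      proof (rule psubsetI)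
        have "{a, b} \<in> {e \<in> E. e \<inter> A \<noteq> {}}" "{a, b} \<notin> {e \<in> E. e \<inter> (A - {a}) \<noteq> {}}"
          using ab by auto
        then show "{e \<in> E. e \<inter> (A - {a}) \<noteq> {}} \<noteq> {e \<in> E. e \<inter> A \<noteq> {}}" by blast
      qed blast
    qed (use finite_E in simp)
    finally show ?case using Suc.hyps(2) by simp
  qed
qed

lemma chi_ge_jensen:
  fixes t :: real
  assumes "t > 0" "real (\<Sum>v\<in>V. (deg E v)\<^sup>2) \<le> t * (real n + 1)"
  shows "chi E \<ge> (real n + 1) / sqrt t"
  unfolding chi_def
  using jensen_inverse_sqrt[of t E "weight E"] assms sum_weight weight_pos card_E
  by (simp add: add_ac)

text \<open>\<open>(d - 1) * (D - d) \<ge> 0\<close> bounds every squared degree by a linear function of the degree.\<close>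

lemma sum_deg_sq_eq:
  fixes D :: int
  shows "(\<Sum>v\<in>V. (int (deg E v) - 1) * (D - int (deg E v)))
    = (D + 1) * (int n + 2) + int n - int (\<Sum>v\<in>V. (deg E v)\<^sup>2)"
proof -
  have "(\<Sum>v\<in>V. (int (deg E v) - 1) * (D - int (deg E v)))
      = (\<Sum>v\<in>V. (D + 1) * int (deg E v) - D - int ((deg E v)\<^sup>2))"
    by (intro sum.cong) (auto simp: algebra_simps power2_eq_square)
  also have "\<dots> = (D + 1) * int (\<Sum>v\<in>V. deg E v) - D * int n - int (\<Sum>v\<in>V. (deg E v)\<^sup>2)"
    using card_V by (simp add: sum_subtractf sum_distrib_left)
  finally show ?thesis unfolding sum_deg by (simp add: algebra_simps)
qed

lemma sum_deg_sq_le: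
  assumes "n \<ge> 2" "\<And>v. v \<in> V \<Longrightarrow> deg E v \<le> D"
  shows "(\<Sum>v\<in>V. (deg E v)\<^sup>2) \<le> (D + 1) * (n + 2) + n"
proof -
  have "0 \<le> (\<Sum>v\<in>V. (int (deg E v) - 1) * (int D - int (deg E v)))"
    using assms deg_pos by (intro sum_nonneg mult_nonneg_nonneg) force+
  then have "int (\<Sum>v\<in>V. (deg E v)\<^sup>2) \<le> int ((D + 1) * (n + 2) + n)"
    unfolding sum_deg_sq_eq by (simp add: algebra_simps)
  then show ?thesis by linarith
qed

end

section \<open>Edges at a chosen centre and edges avoiding it\<close>

locale bicyclic_center = bicyclic_edges V E n for V :: "'a set" and E n +
  fixes c :: 'a and k :: nat
  assumes c_in: "c \<in> V" and n_eq: "n = deg E c + 1 + k"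
begin

definition nbrs :: "'a set" where "nbrs = {v. {c, v} \<in> E}"
definition far :: "'a set" where "far = V - {c} - nbrs"
definition outer :: "'a set set" where "outer = {e \<in> E. c \<notin> e}"

lemma nbrs_subset: "nbrs \<subseteq> V - {c}"
proof
  fix v assume "v \<in> nbrs"
  then have "{c, v} \<in> E" by (simp add: nbrs_def)
  then show "v \<in> V - {c}" using edge_subset card_edge by fastforce
qed

lemma star_edges: "{e \<in> E. c \<in> e} = (\<lambda>v. {c, v}) ` nbrs"
proof -
  have "\<exists>v. e = {c, v}" if "e \<in> E" "c \<in> e" for e
    using edgeE[OF that(1)] that(2) by (auto simp: insert_commute)
  then show ?thesis by (auto simp: nbrs_def)
qed

lemma card_nbrs: "card nbrs = deg E c"
  unfolding deg_def star_edges by (simp add: card_image inj_on_pair)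

lemma finite_nbrs: "finite nbrs"
  using nbrs_subset finite_V finite_subset by blast

lemma card_far: "card far = k"
  unfolding far_def using nbrs_subset finite_nbrs c_in card_nbrs card_V n_eq finite_V
  by (simp add: card_Diff_subset)

lemma E_split: "E = {e \<in> E. c \<in> e} \<union> outer" "{e \<in> E. c \<in> e} \<inter> outer = {}"
  by (auto simp: outer_def)

lemma finite_outer: "finite outer"
  using finite_E by (simp add: outer_def)

lemma card_outer: "card outer = k + 2"
proof -
  have "card E = card {e \<in> E. c \<in> e} + card outer"
    using E_split finite_E finite_outer by (metis (no_types, lifting) card_Un_disjoint finite_Un)
  then show ?thesis using card_E n_eq by (simp add: deg_def)
qed

lemma chi_split: "chi E = (\<Sum>e\<in>{e \<in> E. c \<in> e}. 1 / sqrt (real (weight E e)))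
    + (\<Sum>e\<in>outer. 1 / sqrt (real (weight E e)))"
proof -
  have "chi E = (\<Sum>e\<in>{e \<in> E. c \<in> e} \<union> outer. 1 / sqrt (real (weight E e)))"
    unfolding chi_def using E_split(1) by simp
  then show ?thesis
    using E_split(2) finite_E finite_outer by (simp add: sum.union_disjoint)
qed

text \<open>An edge meeting \<open>e\<close> either avoids \<open>c\<close>, or joins
  \<open>c\<close> to an end of \<open>e\<close> that is a neighbour of \<open>c\<close>. The final
  1 comes from \<open>weight_edge\<close>.\<close>

lemma weight_outer_le:
  assumes "e \<in> outer"
  shows "weight E e \<le> card {e' \<in> outer. e' \<inter> e \<noteq> {}} + card (e \<inter> nbrs) + 1"
proof -
  have e: "e \<in> E" "c \<notin> e" using assms by (auto simp: outer_def)
  have "{e' \<in> E. e' \<inter> e \<noteq> {}} \<subseteq> {e' \<in> outer. e' \<inter> e \<noteq> {}} \<union> (\<lambda>v. {c, v}) ` (e \<inter> nbrs)"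
  proof
    fix e' assume e': "e' \<in> {e' \<in> E. e' \<inter> e \<noteq> {}}"
    show "e' \<in> {e' \<in> outer. e' \<inter> e \<noteq> {}} \<union> (\<lambda>v. {c, v}) ` (e \<inter> nbrs)"
    proof (cases "c \<in> e'")
      case True
      then obtain v where "v \<in> nbrs" "e' = {c, v}" using star_edges e' by blast
      then show ?thesis using e e' by auto
    qed (use e' in \<open>auto simp: outer_def\<close>)
  qed
  then have "card {e' \<in> E. e' \<inter> e \<noteq> {}} \<le> card ({e' \<in> outer. e' \<inter> e \<noteq> {}} \<union> (\<lambda>v. {c, v}) ` (e \<inter> nbrs))"
    using finite_outer finite_nbrs by (intro card_mono) auto
  also have "\<dots> \<le> card {e' \<in> outer. e' \<inter> e \<noteq> {}} + card (e \<inter> nbrs)"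
    using card_Un_le[of "{e' \<in> outer. e' \<inter> e \<noteq> {}}" "(\<lambda>v. {c, v}) ` (e \<inter> nbrs)"]
    by (simp add: card_image inj_on_pair)
  finally show ?thesis using weight_edge[OF e(1)] by simp
qed

lemma card_edge_Int_nbrs:
  assumes "e \<in> E"
  shows "card (e \<inter> nbrs) \<le> 2" "e \<inter> far \<noteq> {} \<Longrightarrow> card (e \<inter> nbrs) \<le> 1"
proof -
  show "card (e \<inter> nbrs) \<le> 2"
    using card_edge[OF assms] finite_edge[OF assms] by (metis Int_lower1 card_mono)
  assume "e \<inter> far \<noteq> {}"
  then have "e \<inter> nbrs \<subset> e" by (auto simp: far_def)
  then have "card (e \<inter> nbrs) < card e"
    using finite_edge[OF assms] by (rule psubset_card_mono[rotated])
  then show "card (e \<inter> nbrs) \<le> 1" using card_edge[OF assms] by simp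
qed

definition far_edges :: "'a set set" where "far_edges = {e \<in> E. e \<inter> far \<noteq> {}}"

lemma far_edges_subset: "far_edges \<subseteq> outer"
proof -
  have "e \<inter> far = {}" if "e \<in> E" "c \<in> e" for e
    using that star_edges by (auto simp: far_def)
  then show ?thesis by (auto simp: far_edges_def outer_def)
qed

lemma card_far_edges: "k \<le> card far_edges"
  using card_touching_ge[of far] card_far c_in by (auto simp: far_edges_def far_def)

lemma card_touching_outer: "card {e' \<in> outer. e' \<inter> e \<noteq> {}} \<le> k + 2"
  using finite_outer card_outer by (metis (no_types, lifting) card_mono mem_Collect_eq subsetI)

lemma weight_outer_bounds:
  assumes "e \<in> outer"
  shows "weight E e \<le> k + 5" "e \<in> far_edges \<Longrightarrow> weight E e \<le> k + 4"
proof -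
  have "e \<in> E" using assms by (simp add: outer_def)
  then show "weight E e \<le> k + 5" "e \<in> far_edges \<Longrightarrow> weight E e \<le> k + 4"
    using weight_outer_le[OF assms] card_touching_outer[of e] card_edge_Int_nbrs[of e]
    by (auto simp: far_edges_def)
qed

text \<open>Of the \<open>k + 2\<close> outer edges at least \<open>k\<close> have weight at most
  \<open>k + 4\<close>, and the others have weight at most \<open>k + 5\<close>. The worst case has
  exactly \<open>k\<close> edges of the first kind.\<close>

lemma outer_sum_ge:
  "(\<Sum>e\<in>outer. 1 / sqrt (real (weight E e))) \<ge> 2 / sqrt (real k + 5) + real k / sqrt (real k + 4)"
proof -
  let ?x = "1 / sqrt (real k + 5)" and ?y = "1 / sqrt (real k + 4)"
  have xy: "?x \<le> ?y" by (simp add: frac_le)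
  have m: "card (outer - far_edges) + card far_edges = k + 2"
    using card_outer far_edges_subset finite_outer
    by (metis add.commute card_Diff_subset card_mono finite_subset le_add_diff_inverse)
  have 1: "(\<Sum>e\<in>far_edges. 1 / sqrt (real (weight E e))) \<ge> (\<Sum>e\<in>far_edges. ?y)"
  proof (rule sum_mono)
    fix e assume e: "e \<in> far_edges"
    then have "e \<in> outer" "weight E e > 0"
      using far_edges_subset weight_pos by (auto simp: far_edges_def)
    then show "1 / sqrt (real (weight E e)) \<ge> ?y"
      using weight_outer_bounds(2)[of e] e by (intro frac_le) (auto simp del: of_nat_add)
  qed
  have 2: "(\<Sum>e\<in>outer - far_edges. 1 / sqrt (real (weight E e))) \<ge> (\<Sum>e\<in>outer - far_edges. ?x)"
  proof (rule sum_mono)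
    fix e assume e: "e \<in> outer - far_edges"
    then have "weight E e > 0" using weight_pos by (auto simp: outer_def)
    then show "1 / sqrt (real (weight E e)) \<ge> ?x"
      using weight_outer_bounds(1)[of e] e by (intro frac_le) auto
  qed
  \<comment> \<open>\<open>j\<close> is the surplus of far edges over the guaranteed
    \<open>k\<close>. Counting them with the heavier weight \<open>k + 5\<close> only lowers the
    bound.\<close>
  obtain j where j: "card far_edges = k + j"
    using card_far_edges le_Suc_ex by blast
  with m have j2: "card (outer - far_edges) + j = 2" by simp
  have "real j * ?x \<le> real j * ?y" using xy by (intro mult_left_mono) auto
  then have "2 * ?x + real k * ?y \<le> (2 - real j) * ?x + (real k + real j) * ?y"
    unfolding left_diff_distrib distrib_right by linarith
  also have "2 - real j = real (card (outer - far_edges))" using j2 by linarith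
  also have "real k + real j = real (card far_edges)" using j by simp
  also have "real (card (outer - far_edges)) * ?x + real (card far_edges) * ?y
      \<le> (\<Sum>e\<in>outer. 1 / sqrt (real (weight E e)))"
    using 1 2 sum.subset_diff[OF far_edges_subset finite_outer, of "\<lambda>e. 1 / sqrt (real (weight E e))"]
    by simp
  finally show ?thesis by simp
qed

text \<open>With D the degree of \<open>c\<close>, the weights at \<open>c\<close> add up to D^2
  plus the degree sum of the neighbours. To that degree sum each edge at \<open>c\<close>
  contributes 1 and each outer edge at most 2, or at most 1 if it is far; at least \<open>k\<close>
  of the \<open>k + 2\<close> outer edges are far.\<close>

lemma sum_weight_star_le:
  "(\<Sum>e\<in>{e \<in> E. c \<in> e}. weight E e) \<le> deg E c * (deg E c + 1) + (k + 4)"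
proof -
  have c: "c \<notin> nbrs" using nbrs_subset by auto
  have "(\<Sum>e\<in>{e \<in> E. c \<in> e}. weight E e) = (\<Sum>v\<in>nbrs. weight E {c, v})"
    unfolding star_edges by (subst sum.reindex[OF inj_on_pair]) simp
  also have "\<dots> = (\<Sum>v\<in>nbrs. deg E c + deg E v)"
  proof (rule sum.cong)
    fix v assume "v \<in> nbrs"
    then have "c \<noteq> v" using c by auto
    then show "weight E {c, v} = deg E c + deg E v" by (simp add: weight_def)
  qed simp
  also have "\<dots> = deg E c * deg E c + (\<Sum>e\<in>E. card (e \<inter> nbrs))"
    by (simp add: sum.distrib card_nbrs sum_deg_eq_sum_card[OF finite_E finite_nbrs])
  also have "(\<Sum>e\<in>E. card (e \<inter> nbrs)) = (\<Sum>e\<in>{e \<in> E. c \<in> e}. card (e \<inter> nbrs)) + (\<Sum>e\<in>outer. card (e \<inter> nbrs))"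
    using E_split finite_E finite_outer
    by (metis (no_types, lifting) finite_Un sum.union_disjoint)
  also have "(\<Sum>e\<in>{e \<in> E. c \<in> e}. card (e \<inter> nbrs)) = (\<Sum>v\<in>nbrs. card ({c, v} \<inter> nbrs))"
    unfolding star_edges by (subst sum.reindex[OF inj_on_pair]) simp
  also have "\<dots> = deg E c" using c by (simp add: card_nbrs)
  also have "(\<Sum>e\<in>outer. card (e \<inter> nbrs)) \<le> (\<Sum>e\<in>outer. 2 - of_bool (e \<in> far_edges))"
    using card_edge_Int_nbrs by (intro sum_mono) (fastforce simp: outer_def far_edges_def)
  also have "\<dots> \<le> k + 4"
  proof -
    have "(\<Sum>e\<in>outer. 2 - of_bool (e \<in> far_edges)) + (\<Sum>e\<in>outer. of_bool (e \<in> far_edges)) = (\<Sum>e\<in>outer. 2::nat)"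
      unfolding sum.distrib[symmetric] by (intro sum.cong) (auto simp: of_bool_def)
    moreover have "(\<Sum>e\<in>outer. of_bool (e \<in> far_edges)) = card far_edges"
      using finite_outer far_edges_subset by (simp add: of_bool_def sum.If_cases Int_absorb1)
    ultimately show ?thesis using card_far_edges card_outer by simp
  qed
  finally show ?thesis by (simp add: algebra_simps)
qed

text \<open>The tangent point stays free: it becomes D + 1 for \<open>n \<ge> 8\<close>, D being the
  degree of \<open>c\<close>, and the mean weight 25/4 or 7 in the cases with \<open>k = 1\<close>
  for \<open>n = 6\<close> and \<open>n = 7\<close>.\<close>

lemma star_sum_ge:
  fixes t :: real
  assumes "t > 0"
  shows "(\<Sum>e\<in>{e \<in> E. c \<in> e}. 1 / sqrt (real (weight E e)))
    \<ge> 3 * real (deg E c) / (2 * sqrt t)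
      - (real (deg E c) * (real (deg E c) + 1) + (real k + 4)) / (2 * t * sqrt t)"
proof -
  have "real (\<Sum>e\<in>{e \<in> E. c \<in> e}. weight E e) \<le> real (deg E c * (deg E c + 1) + (k + 4))"
    using sum_weight_star_le of_nat_le_iff by blast
  also have "\<dots> = real (deg E c) * (real (deg E c) + 1) + (real k + 4)"
    by (simp add: algebra_simps)
  finally show ?thesis
    using sum_inverse_sqrt_ge[OF assms, of "{e \<in> E. c \<in> e}" "weight E"] weight_pos
    unfolding deg_def[of E c, symmetric] by blast
qed

end

section \<open>Comparison of the bounds with the index of \<open>B_{n,3}\<close>\<close>

text \<open>Once \<open>divide_sqrt\<close> and \<open>divide_mult_sqrt\<close> have moved all roots
  into numerators, the numerical comparisons are linear in these roots, and five decimals decide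
  them.\<close>

lemma sqrt_bounds:
  "223606 / 100000 < sqrt (5::real)" "sqrt (5::real) < 223607 / 100000"
  "244948 / 100000 < sqrt (6::real)" "sqrt (6::real) < 244949 / 100000"
  "264575 / 100000 < sqrt (7::real)" "sqrt (7::real) < 264576 / 100000"
  "282842 / 100000 < sqrt (8::real)" "sqrt (8::real) < 282843 / 100000"
  "316227 / 100000 < sqrt (10::real)" "sqrt (10::real) < 316228 / 100000"
  "331662 / 100000 < sqrt (11::real)" "sqrt (11::real) < 331663 / 100000"
  by (rule real_less_rsqrt real_less_lsqrt; simp add: power2_eq_square)+

lemma sqrt_nine: "sqrt (9::real) = 3"
  by (rule real_sqrt_unique) auto

lemma divide_sqrt: "y / sqrt x = y * sqrt x / x" if "x > 0" for x y :: real
  using that by (simp add: field_simps)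

lemma divide_mult_sqrt: "y / (z * sqrt x) = y * sqrt x / (z * x)" if "x > 0" for x y z :: real
  using that by (cases "z = 0") (simp_all add: field_simps)

definition chi_B3 :: "real \<Rightarrow> real" where
  "chi_B3 x = 4 / sqrt (x + 1) + (x - 5) / sqrt x + 1"

text \<open>Replacing \<open>x + 1\<close> by \<open>x\<close> under the first root leaves an
  expression in sqrt x alone, which can be compared with polynomials.\<close>

lemma chi_B3_upper:
  assumes "x > 0"
  shows "chi_B3 x \<le> sqrt x + 1 - 1 / sqrt x"
proof -
  have "4 / sqrt (x + 1) \<le> 4 / sqrt x" using assms by (intro divide_left_mono) auto
  moreover have "(x - 5) / sqrt x = sqrt x - 5 / sqrt x"
    using assms by (simp add: diff_divide_distrib real_div_sqrt)
  ultimately show ?thesis by (simp add: chi_B3_def diff_divide_distrib)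
qed

text \<open>Here \<open>a = sqrt p\<close> and \<open>b = sqrt q\<close> with \<open>p = D + 1\<close>, \<open>q = k + 4\<close>, so that \<open>p + q = n + 4\<close>.\<close>

lemma center_bound_aux:
  fixes a b x :: real
  assumes a: "a > 0" and b: "b > 0" and x: "x > 0" "x = a\<^sup>2 + b\<^sup>2 - 4"
    and main: "b - 1 - 4 / b + 2 / sqrt (b\<^sup>2 + 1) > (b\<^sup>2 - 4) / (2 * a) + (b\<^sup>2 - 2) / a ^ 3"
  shows "chi_B3 x < 2 / sqrt (b\<^sup>2 + 1) + (b\<^sup>2 - 4) / b + (a\<^sup>2 - 1) / a - b\<^sup>2 / (2 * a ^ 3)"
proof -
  \<comment> \<open>This is the tangent bound for the square root at \<open>a\<^sup>2\<close>, where
    \<open>x - a\<^sup>2 = b\<^sup>2 - 4\<close>. The reciprocal root is treated by its own tangent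
    at the same point, so that \<open>a\<close> and \<open>1 / a\<close> cancel and exactly
    \<open>main\<close> remains.\<close>
  have "0 \<le> (a - sqrt x)\<^sup>2" by simp
  then have "2 * a * sqrt x \<le> 2 * a\<^sup>2 + b\<^sup>2 - 4"
    using x by (simp add: power2_diff)
  then have 1: "sqrt x \<le> a + (b\<^sup>2 - 4) / (2 * a)"
    using a by (simp add: field_simps power2_eq_square)
  have "1 / sqrt x \<ge> 3 / (2 * sqrt (a\<^sup>2)) - x / (2 * a\<^sup>2 * sqrt (a\<^sup>2))"
    using inverse_sqrt_tangent[of x "a\<^sup>2"] x a by simp
  also have "3 / (2 * sqrt (a\<^sup>2)) - x / (2 * a\<^sup>2 * sqrt (a\<^sup>2)) = 1 / a - (b\<^sup>2 - 4) / (2 * a ^ 3)"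
    using a by (simp add: x(2) field_simps power2_eq_square power3_eq_cube)
  finally have 2: "1 / sqrt x \<ge> 1 / a - (b\<^sup>2 - 4) / (2 * a ^ 3)" .
  have 3: "(b\<^sup>2 - 4) / b = b - 4 / b" "(a\<^sup>2 - 1) / a = a - 1 / a"
    using a b by (simp_all add: field_simps power2_eq_square)
  have 4: "(b\<^sup>2 - 2) / a ^ 3 = (b\<^sup>2 - 4) / (2 * a ^ 3) + b\<^sup>2 / (2 * a ^ 3)"
    using a by (simp add: field_simps)
  show ?thesis
    using chi_B3_upper[OF x(1)] 1 2 3 4 main by linarith
qed

text \<open>The right side of the main inequality decreases in \<open>a\<close>, so it only has to
  be checked at the smallest admissible \<open>a\<close>.\<close>

lemma center_main_mono:
  fixes a a0 b :: real
  assumes "0 < a0" "a0 \<le> a" "b\<^sup>2 \<ge> 4"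
  shows "(b\<^sup>2 - 4) / (2 * a) + (b\<^sup>2 - 2) / a ^ 3 \<le> (b\<^sup>2 - 4) / (2 * a0) + (b\<^sup>2 - 2) / a0 ^ 3"
  using assms by (intro add_mono divide_left_mono power_mono mult_pos_pos zero_less_power) auto

text \<open>This is the main inequality at \<open>a = b\<close>, the smallest \<open>a\<close>
  allowed by \<open>2 * k + 4 \<le> n\<close>, for \<open>k \<ge> 4\<close>. The tangent at
  \<open>b\<^sup>2\<close> removes the root of \<open>b\<^sup>2 + 1\<close>, and what remains
  follows from \<open>b\<^sup>2 - 2 * b - 2 > 0\<close>, that is (b - 1)^2 > 3.\<close>

lemma center_main_large:
  fixes b :: real
  assumes "b > 0" "b\<^sup>2 \<ge> 8"
  shows "b - 1 - 4 / b + 2 / sqrt (b\<^sup>2 + 1) > (b\<^sup>2 - 4) / (2 * b) + (b\<^sup>2 - 2) / b ^ 3"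
proof -
  have "b \<ge> sqrt 8" using assms by (intro real_le_lsqrt) auto
  then have "b > 28 / 10" using sqrt_bounds(7) by linarith
  then have "(b - 1)\<^sup>2 > (18 / 10)\<^sup>2" by (intro power_strict_mono) auto
  then have pos: "b\<^sup>2 - 2 * b - 2 > 0" by (simp add: power2_eq_square algebra_simps)
  have "1 / sqrt (b\<^sup>2 + 1) \<ge> 3 / (2 * sqrt (b\<^sup>2)) - (b\<^sup>2 + 1) / (2 * b\<^sup>2 * sqrt (b\<^sup>2))"
    using assms by (intro inverse_sqrt_tangent) (auto intro: add_pos_pos)
  also have "3 / (2 * sqrt (b\<^sup>2)) - (b\<^sup>2 + 1) / (2 * b\<^sup>2 * sqrt (b\<^sup>2)) = 1 / b - 1 / (2 * b ^ 3)"
    using assms(1) by (simp add: field_simps power2_eq_square power3_eq_cube)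
  finally have 1: "2 / sqrt (b\<^sup>2 + 1) \<ge> 2 / b - 1 / b ^ 3" by simp
  have "b - 1 - 4 / b + (2 / b - 1 / b ^ 3) - ((b\<^sup>2 - 4) / (2 * b) + (b\<^sup>2 - 2) / b ^ 3)
      = (b\<^sup>2 * (b\<^sup>2 - 2 * b - 2) + 2) / (2 * b ^ 3)"
    using assms(1) by (simp add: field_simps power2_eq_square power3_eq_cube)
  also have "\<dots> > 0" using pos assms(1) by (intro divide_pos_pos add_nonneg_pos) auto
  finally show ?thesis using 1 by linarith
qed

text \<open>The alternatives are \<open>k = 1, 2, 3\<close> with D at least 9, 7, 6. For
  \<open>k = 1\<close> and \<open>k = 2\<close> the simplified inequality fails one step earlier, so
  the smaller D are left to direct evaluation in \<open>center_bound\<close>.\<close>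

lemma center_main_small:
  fixes a b :: real
  assumes "a > 0" "b > 0"
    and "b\<^sup>2 = 5 \<and> a\<^sup>2 \<ge> 10 \<or> b\<^sup>2 = 6 \<and> a\<^sup>2 \<ge> 8 \<or> b\<^sup>2 = 7 \<and> a\<^sup>2 \<ge> 7"
  shows "b - 1 - 4 / b + 2 / sqrt (b\<^sup>2 + 1) > (b\<^sup>2 - 4) / (2 * a) + (b\<^sup>2 - 2) / a ^ 3"
proof -
  have cube: "sqrt y ^ 3 = y * sqrt y" if "y \<ge> 0" for y :: real
    using that by (simp add: power3_eq_cube)
  from assms(3) consider "b\<^sup>2 = 5" "a\<^sup>2 \<ge> 10" | "b\<^sup>2 = 6" "a\<^sup>2 \<ge> 8" | "b\<^sup>2 = 7" "a\<^sup>2 \<ge> 7" by blast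
  then show ?thesis
  proof cases
    case 1
    have a: "sqrt 10 \<le> a" using 1 assms(1) by (intro real_le_lsqrt) auto
    have b: "b = sqrt 5" using 1 assms(2) by (intro real_sqrt_unique[symmetric]) auto
    have "(b\<^sup>2 - 4) / (2 * sqrt 10) + (b\<^sup>2 - 2) / sqrt 10 ^ 3 < b - 1 - 4 / b + 2 / sqrt (b\<^sup>2 + 1)"
      using sqrt_bounds unfolding b by (simp add: cube divide_sqrt divide_mult_sqrt)
    then show ?thesis using center_main_mono[OF _ a, of b] 1 by simp
  next
    case 2
    have a: "sqrt 8 \<le> a" using 2 assms(1) by (intro real_le_lsqrt) auto
    have b: "b = sqrt 6" using 2 assms(2) by (intro real_sqrt_unique[symmetric]) auto
    have "(b\<^sup>2 - 4) / (2 * sqrt 8) + (b\<^sup>2 - 2) / sqrt 8 ^ 3 < b - 1 - 4 / b + 2 / sqrt (b\<^sup>2 + 1)"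
      using sqrt_bounds unfolding b by (simp add: cube divide_sqrt divide_mult_sqrt)
    then show ?thesis using center_main_mono[OF _ a, of b] 2 by simp
  next
    case 3
    have a: "sqrt 7 \<le> a" using 3 assms(1) by (intro real_le_lsqrt) auto
    have b: "b = sqrt 7" using 3 assms(2) by (intro real_sqrt_unique[symmetric]) auto
    have "(b\<^sup>2 - 4) / (2 * sqrt 7) + (b\<^sup>2 - 2) / sqrt 7 ^ 3 < b - 1 - 4 / b + 2 / sqrt (b\<^sup>2 + 1)"
      using sqrt_bounds unfolding b by (simp add: cube divide_sqrt divide_mult_sqrt)
    then show ?thesis using center_main_mono[OF _ a, of b] 3 by simp
  qed
qed

text \<open>With \<open>a\<^sup>2 = D + 1\<close>, the right side is the bound of
  \<open>star_sum_ge\<close> at \<open>t = D + 1\<close>, the weight of an edge from the centre to a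
  leaf.\<close>

lemma center_identity:
  fixes a c :: real
  assumes "a \<noteq> 0"
  shows "(a\<^sup>2 - 1) / a - c / (2 * a ^ 3) = 3 * (a\<^sup>2 - 1) / (2 * a) - ((a\<^sup>2 - 1) * a\<^sup>2 + c) / (2 * a\<^sup>2 * a)"
  using assms by (simp add: divide_simps power2_eq_square power3_eq_cube)

lemma center_bound:
  fixes n k D :: nat
  assumes n: "n = D + 1 + k" and "n \<ge> 8" "k \<ge> 1" "2 * k + 4 \<le> n"
  defines "t \<equiv> real D + 1"
  shows "chi_B3 (real n) < 2 / sqrt (real k + 5) + real k / sqrt (real k + 4)
    + (3 * real D / (2 * sqrt t) - (real D * (real D + 1) + (real k + 4)) / (2 * t * sqrt t))"
proof -
  define a b where "a = sqrt t" and "b = sqrt (real k + 4)"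
  have ab: "a > 0" "b > 0" "a\<^sup>2 = real D + 1" "b\<^sup>2 = real k + 4"
    by (auto simp: a_def b_def t_def)
  have general: ?thesis
    if "b - 1 - 4 / b + 2 / sqrt (b\<^sup>2 + 1) > (b\<^sup>2 - 4) / (2 * a) + (b\<^sup>2 - 2) / a ^ 3"
  proof -
    have "chi_B3 (real n) < 2 / sqrt (b\<^sup>2 + 1) + (b\<^sup>2 - 4) / b + (a\<^sup>2 - 1) / a - b\<^sup>2 / (2 * a ^ 3)"
      using ab n by (intro center_bound_aux that) auto
    also have "2 / sqrt (b\<^sup>2 + 1) + (b\<^sup>2 - 4) / b = 2 / sqrt (real k + 5) + real k / sqrt (real k + 4)"
      using ab by (simp add: b_def add_ac)
    also have "2 / sqrt (real k + 5) + real k / sqrt (real k + 4) + (a\<^sup>2 - 1) / a - b\<^sup>2 / (2 * a ^ 3)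
      = 2 / sqrt (real k + 5) + real k / sqrt (real k + 4) + ((a\<^sup>2 - 1) / a - b\<^sup>2 / (2 * a ^ 3))"
      by simp
    also have "(a\<^sup>2 - 1) / a - b\<^sup>2 / (2 * a ^ 3) = 3 * (a\<^sup>2 - 1) / (2 * a) - ((a\<^sup>2 - 1) * a\<^sup>2 + b\<^sup>2) / (2 * a\<^sup>2 * a)"
      using center_identity[of a "b\<^sup>2"] ab(1) by simp
    also have "\<dots> = 3 * real D / (2 * sqrt t) - (real D * (real D + 1) + (real k + 4)) / (2 * t * sqrt t)"
      unfolding ab(3,4) by (simp add: a_def t_def)
    finally show ?thesis .
  qed
  consider "k = 1" | "k = 2" | "k = 3" | "k \<ge> 4" using assms(3) by linarith
  then show ?thesis
  proof cases
    case 1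
    then consider "D = 6" | "D = 7" | "D = 8" | "D \<ge> 9" using assms(2) n by linarith
    then show ?thesis
    proof cases
      \<comment> \<open>For the remaining small D the estimate \<open>chi_B3_upper\<close> and the
        tangents lose too much, so the original bound is evaluated numerically.\<close>
      case 1
      then show ?thesis using \<open>k = 1\<close> sqrt_bounds by (simp add: n t_def chi_B3_def sqrt_nine divide_sqrt divide_mult_sqrt)
    next
      case 2
      then show ?thesis using \<open>k = 1\<close> sqrt_bounds by (simp add: n t_def chi_B3_def sqrt_nine divide_sqrt divide_mult_sqrt)
    next
      case 3
      then show ?thesis using \<open>k = 1\<close> sqrt_bounds by (simp add: n t_def chi_B3_def sqrt_nine divide_sqrt divide_mult_sqrt)
    next
      case 4
      then show ?thesis using \<open>k = 1\<close> ab by (intro general center_main_small) auto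
    qed
  next
    case 2
    then consider "D = 5" | "D = 6" | "D \<ge> 7" using assms(2) n by linarith
    then show ?thesis
    proof cases
      case 1
      then show ?thesis using \<open>k = 2\<close> sqrt_bounds by (simp add: n t_def chi_B3_def sqrt_nine divide_sqrt divide_mult_sqrt)
    next
      case 2
      then show ?thesis using \<open>k = 2\<close> sqrt_bounds by (simp add: n t_def chi_B3_def sqrt_nine divide_sqrt divide_mult_sqrt)
    next
      case 3
      then show ?thesis using \<open>k = 2\<close> ab by (intro general center_main_small) auto
    qed
  next
    case 3
    then have "D \<ge> 6" using assms(4) n by linarith
    then show ?thesis using 3 ab by (intro general center_main_small) auto
  next
    case 4
    \<comment> \<open>The hypothesis \<open>2 * k + 4 \<le> n\<close> says precisely that D is at
      least \<open>k + 3\<close>, hence \<open>b \<le> a\<close>.\<close>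
    have "real k + 4 \<le> real D + 1" using assms(4) n by linarith
    then have "b \<le> a" by (simp add: a_def b_def t_def)
    moreover have "b\<^sup>2 \<ge> 8" using 4 ab by simp
    ultimately show ?thesis
      using center_main_mono[of b a b] center_main_large[of b] ab(2) by (intro general) simp
  qed
qed

text \<open>The upper bound \<open>chi_B3_upper\<close> becomes a rational function of s = sqrt x;
  clearing denominators and squaring turns the claim into a polynomial inequality in s. The value
  \<open>(x + 6) / 2\<close> bounds the mean weight when the maximum degree is small.\<close>

lemma jensen_bound:
  fixes x :: real
  assumes "x \<ge> 10"
  shows "chi_B3 x < (x + 1) / sqrt ((x + 6) / 2)"
proof -
  define s where "s = sqrt x"
  have s: "s > 0" "s\<^sup>2 = x" using assms by (auto simp: s_def)
  have "10 \<le> s\<^sup>2" using assms s by simp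
  have "sqrt 10 \<le> s" using assms by (simp add: s_def)
  then have s3: "s \<ge> 316 / 100" using sqrt_bounds by linarith
  \<comment> \<open>The larger root of the quadratic below is about 3.08, so the lower bound 3.16
    for sqrt 10 suffices; the square at 3.16 makes the goal linear in \<open>s\<close>.\<close>
  have "0 \<le> (s - 316 / 100)\<^sup>2" by simp
  then have "9 * s\<^sup>2 - 30 * s + 7 > 0" using s3 by (simp add: power2_eq_square algebra_simps)
  then have "0 < s\<^sup>2 * (9 * s\<^sup>2 - 30 * s + 7)"
    using s(1) by (intro mult_pos_pos) auto
  then have "0 < s\<^sup>2 * (9 * s\<^sup>2 - 30 * s + 7) + 12 * s - 6"
    using s3 by linarith
  also have "\<dots> = s ^ 3 * (10 * (s - 2) - s - 10) + 7 * s\<^sup>2 + 12 * s - 6"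
    by (simp add: algebra_simps power2_eq_square power3_eq_cube)
  \<comment> \<open>Using \<open>10 \<le> s\<^sup>2\<close> in one factor is the only loss in
    passing from the quartic to the sextic polynomial; it needs \<open>s \<ge> 2\<close>.\<close>
  also have "\<dots> \<le> s ^ 3 * (s\<^sup>2 * (s - 2) - s - 10) + 7 * s\<^sup>2 + 12 * s - 6"
    using s(1) s3 \<open>10 \<le> s\<^sup>2\<close> by (intro diff_right_mono add_right_mono mult_left_mono mult_right_mono) auto
  also have "\<dots> = 2 * ((s * (s\<^sup>2 + 1))\<^sup>2 - (s\<^sup>2 + 6) / 2 * (s\<^sup>2 + s - 1)\<^sup>2)"
    by (simp add: field_simps power2_eq_square power3_eq_cube)
  finally have poly: "(s\<^sup>2 + 6) / 2 * (s\<^sup>2 + s - 1)\<^sup>2 < (s * (s\<^sup>2 + 1))\<^sup>2" by simp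
  have pos: "s\<^sup>2 + s - 1 > 0" using s assms by simp
  have "sqrt ((s\<^sup>2 + 6) / 2) * (s\<^sup>2 + s - 1) = sqrt ((s\<^sup>2 + 6) / 2 * (s\<^sup>2 + s - 1)\<^sup>2)"
    unfolding real_sqrt_mult using pos by simp
  also have "\<dots> < s * (s\<^sup>2 + 1)"
    using poly s by (intro real_less_lsqrt) auto
  finally have main: "(s\<^sup>2 + s - 1) * sqrt ((s\<^sup>2 + 6) / 2) < (s\<^sup>2 + 1) * s" by (simp add: mult_ac)
  have "chi_B3 x \<le> s + 1 - 1 / s"
    using chi_B3_upper[of x] assms by (simp add: s_def)
  also have "\<dots> = (s\<^sup>2 + s - 1) / s" using s(1) by (simp add: field_simps power2_eq_square)
  also have "\<dots> < (s\<^sup>2 + 1) / sqrt ((s\<^sup>2 + 6) / 2)"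
    using main s assms by (intro mult_imp_div_pos_less mult_imp_less_div_pos) (auto simp: field_simps)
  finally show ?thesis using s by simp
qed

lemma jensen_bound_8_9:
  "chi_B3 8 < 9 / sqrt 7" "chi_B3 9 < 10 / sqrt (121 / 16)"
proof -
  show "chi_B3 8 < 9 / sqrt 7"
    using sqrt_bounds by (simp add: chi_B3_def sqrt_nine divide_sqrt)
  have "sqrt (121 / 16) = (11 / 4 :: real)"
    by (rule real_sqrt_unique) (auto simp: power2_eq_square)
  then show "chi_B3 9 < 10 / sqrt (121 / 16)"
    using sqrt_bounds by (simp add: chi_B3_def sqrt_nine divide_sqrt)
qed

section \<open>The extremal graphs\<close>

text \<open>
  The edge sets of \<open>B_n(n-1,3)\<close>, \<open>B_{n,3}\<close>, \<open>B_n(n-2,4)\<close> and of \<open>K_4 - e\<close> with a pendent vertex \<open>l\<close>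
  attached to the vertex \<open>v\<close> of degree two.
\<close>

definition M_shape :: "'a set \<Rightarrow> 'a set set \<Rightarrow> bool" where
  "M_shape V E \<longleftrightarrow> (\<exists>c a x y. distinct [c, a, x, y] \<and> {c, a, x, y} \<subseteq> V \<and>
     E = insert {a, x} (insert {a, y} (star (V - {c}) c)))"

definition B3_shape :: "'a set \<Rightarrow> 'a set set \<Rightarrow> bool" where
  "B3_shape V E \<longleftrightarrow> (\<exists>c x y z w. distinct [c, x, y, z, w] \<and> {c, x, y, z, w} \<subseteq> V \<and>
     E = insert {x, y} (insert {z, w} (star (V - {c}) c)))"

definition B4_shape :: "'a set \<Rightarrow> 'a set set \<Rightarrow> bool" where
  "B4_shape V E \<longleftrightarrow> (\<exists>c a x y f. distinct [c, a, x, y, f] \<and> {c, a, x, y, f} \<subseteq> V \<and>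
     E = insert {a, x} (insert {a, y} (insert {a, f} (star (V - {c, f}) c))))"

definition P5_shape :: "'a set \<Rightarrow> 'a set set \<Rightarrow> bool" where
  "P5_shape V E \<longleftrightarrow> (\<exists>l v w x y. distinct [l, v, w, x, y] \<and> V = {l, v, w, x, y} \<and>
     E = {{x, y}, {v, x}, {v, y}, {w, x}, {w, y}, {l, v}})"

section \<open>Each shape determines the graph up to isomorphism\<close>

lemma bij_betw_image_Diff:
  assumes "bij_betw f V W" "A \<subseteq> V"
  shows "f ` (V - A) = W - f ` A"
  using assms by (metis Diff_subset bij_betw_def inj_on_image_set_diff)

lemma M_shape_iso:
  assumes "pair_graph G" "pair_graph H" "card (pverts G) = card (pverts H)"
    and "M_shape (pverts G) (uedges G)" "M_shape (pverts H) (uedges H)"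
  shows "G \<simeq>\<^sub>g H"
proof -
  from assms(4) obtain c a x y where G: "distinct [c, a, x, y]" "{c, a, x, y} \<subseteq> pverts G"
    "uedges G = insert {a, x} (insert {a, y} (star (pverts G - {c}) c))"
    unfolding M_shape_def by (elim exE conjE) (rule that)
  from assms(5) obtain c' a' x' y' where H: "distinct [c', a', x', y']" "{c', a', x', y'} \<subseteq> pverts H"
    "uedges H = insert {a', x'} (insert {a', y'} (star (pverts H - {c'}) c'))"
    unfolding M_shape_def by (elim exE conjE) (rule that)
  have "\<exists>f. bij_betw f (pverts G) (pverts H) \<and> map f [c, a, x, y] = [c', a', x', y']"
    using assms(3) G(1,2) H(1,2) pair_graph_finite[OF assms(1)] pair_graph_finite[OF assms(2)]
    by (intro bij_betw_extend_lists) auto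
  then obtain f where f: "bij_betw f (pverts G) (pverts H)" "map f [c, a, x, y] = [c', a', x', y']"
    by (elim exE conjE) (rule that)
  have "f ` (pverts G - {c}) = pverts H - {c'}"
    using bij_betw_image_Diff[OF f(1), of "{c}"] f(2) G(2) by simp
  then have "(`) f ` uedges G = uedges H"
    unfolding G(3) H(3) using f(2) by (simp only: image_star image_insert image_empty list.map list.inject)
  with graph_isoI[OF assms(1,2) f(1)] show ?thesis .
qed

lemma B3_shape_iso:
  assumes "pair_graph G" "pair_graph H" "card (pverts G) = card (pverts H)"
    and "B3_shape (pverts G) (uedges G)" "B3_shape (pverts H) (uedges H)"
  shows "G \<simeq>\<^sub>g H"
proof -
  from assms(4) obtain c x y z w where G: "distinct [c, x, y, z, w]" "{c, x, y, z, w} \<subseteq> pverts G"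
    "uedges G = insert {x, y} (insert {z, w} (star (pverts G - {c}) c))"
    unfolding B3_shape_def by (elim exE conjE) (rule that)
  from assms(5) obtain c' x' y' z' w' where H: "distinct [c', x', y', z', w']" "{c', x', y', z', w'} \<subseteq> pverts H"
    "uedges H = insert {x', y'} (insert {z', w'} (star (pverts H - {c'}) c'))"
    unfolding B3_shape_def by (elim exE conjE) (rule that)
  have "\<exists>f. bij_betw f (pverts G) (pverts H) \<and> map f [c, x, y, z, w] = [c', x', y', z', w']"
    using assms(3) G(1,2) H(1,2) pair_graph_finite[OF assms(1)] pair_graph_finite[OF assms(2)]
    by (intro bij_betw_extend_lists) auto
  then obtain f where f: "bij_betw f (pverts G) (pverts H)" "map f [c, x, y, z, w] = [c', x', y', z', w']"
    by (elim exE conjE) (rule that)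
  have "f ` (pverts G - {c}) = pverts H - {c'}"
    using bij_betw_image_Diff[OF f(1), of "{c}"] f(2) G(2) by simp
  then have "(`) f ` uedges G = uedges H"
    unfolding G(3) H(3) using f(2) by (simp only: image_star image_insert image_empty list.map list.inject)
  with graph_isoI[OF assms(1,2) f(1)] show ?thesis .
qed

lemma B4_shape_iso:
  assumes "pair_graph G" "pair_graph H" "card (pverts G) = card (pverts H)"
    and "B4_shape (pverts G) (uedges G)" "B4_shape (pverts H) (uedges H)"
  shows "G \<simeq>\<^sub>g H"
proof -
  from assms(4) obtain c a x y u where G: "distinct [c, a, x, y, u]" "{c, a, x, y, u} \<subseteq> pverts G"
    "uedges G = insert {a, x} (insert {a, y} (insert {a, u} (star (pverts G - {c, u}) c)))"
    unfolding B4_shape_def by (elim exE conjE) (rule that)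
  from assms(5) obtain c' a' x' y' u' where H: "distinct [c', a', x', y', u']" "{c', a', x', y', u'} \<subseteq> pverts H"
    "uedges H = insert {a', x'} (insert {a', y'} (insert {a', u'} (star (pverts H - {c', u'}) c')))"
    unfolding B4_shape_def by (elim exE conjE) (rule that)
  have "\<exists>f. bij_betw f (pverts G) (pverts H) \<and> map f [c, a, x, y, u] = [c', a', x', y', u']"
    using assms(3) G(1,2) H(1,2) pair_graph_finite[OF assms(1)] pair_graph_finite[OF assms(2)]
    by (intro bij_betw_extend_lists) auto
  then obtain f where f: "bij_betw f (pverts G) (pverts H)" "map f [c, a, x, y, u] = [c', a', x', y', u']"
    by (elim exE conjE) (rule that)
  have "f ` (pverts G - {c, u}) = pverts H - {c', u'}"
    using bij_betw_image_Diff[OF f(1), of "{c, u}"] f(2) G(2) by simp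
  then have "(`) f ` uedges G = uedges H"
    unfolding G(3) H(3) using f(2) by (simp only: image_star image_insert image_empty list.map list.inject)
  with graph_isoI[OF assms(1,2) f(1)] show ?thesis .
qed

lemma P5_shape_iso:
  assumes "pair_graph G" "pair_graph H"
    and "P5_shape (pverts G) (uedges G)" "P5_shape (pverts H) (uedges H)"
  shows "G \<simeq>\<^sub>g H"
proof -
  from assms(3) obtain l v w x y where G: "distinct [l, v, w, x, y]" "pverts G = {l, v, w, x, y}"
    "uedges G = {{x, y}, {v, x}, {v, y}, {w, x}, {w, y}, {l, v}}"
    unfolding P5_shape_def by (elim exE conjE) (rule that)
  from assms(4) obtain l' v' w' x' y' where H: "distinct [l', v', w', x', y']" "pverts H = {l', v', w', x', y'}"
    "uedges H = {{x', y'}, {v', x'}, {v', y'}, {w', x'}, {w', y'}, {l', v'}}"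
    unfolding P5_shape_def by (elim exE conjE) (rule that)
  have card: "card (pverts G) = card (pverts H)" using G(1) H(1) by (simp add: G(2) H(2))
  have "\<exists>f. bij_betw f (pverts G) (pverts H) \<and> map f [l, v, w, x, y] = [l', v', w', x', y']"
    using card G(1,2) H(1,2) by (intro bij_betw_extend_lists) auto
  then obtain f where f: "bij_betw f (pverts G) (pverts H)" "map f [l, v, w, x, y] = [l', v', w', x', y']"
    by (elim exE conjE) (rule that)
  then have "(`) f ` uedges G = uedges H"
    unfolding G(3) H(3) by simp
  with graph_isoI[OF assms(1,2) f(1)] show ?thesis .
qed

section \<open>The index of each shape\<close>

lemma M_shape_chi:
  assumes "finite V" "card V = n" "M_shape V E"
  shows "chi E = 1 / sqrt (real n + 2) + (real n - 4) / sqrt (real n) + 2 / sqrt (real n + 1) + 2 / sqrt 5"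
proof -
  from assms(3) obtain c a x y where d: "distinct [c, a, x, y]" and sub: "{c, a, x, y} \<subseteq> V"
    and E: "E = insert {a, x} (insert {a, y} (star (V - {c}) c))"
    unfolding M_shape_def by (elim exE conjE) (rule that)
  \<comment> \<open>The reversed list supplies every disequality in the opposite orientation for the
    simplifier.\<close>
  have d': "distinct [y, x, a, c]" using d by auto
  define S where "S = star (V - {c}) c"
  have S: "finite S" "{a, x} \<notin> insert {a, y} S" "{a, y} \<notin> S"
    using assms(1) d d' by (auto simp: S_def finite_star doubleton_in_star doubleton_eq_iff)
  have card: "card (V - {c}) = n - 1" using assms sub by simp
  have "card {c, a, x, y} \<le> n" using sub assms card_mono by blast
  then have n: "n \<ge> 4" using d d' by simp
  have deg: "deg E v = (if v = c then n - 1 else of_bool (v \<in> V)) + of_bool (v = a \<or> v = y) + of_bool (v = a \<or> v = x)" for v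
    unfolding E using S card by (simp add: S_def[symmetric] deg_insert) (simp add: S_def deg_star)
  have inV: "c \<in> V" "a \<in> V" "x \<in> V" "y \<in> V" using sub by auto
  have degs: "deg E c = n - 1" "deg E a = 3" "deg E x = 2" "deg E y = 2"
    using d d' inV by (simp_all add: deg)
  have deg_rest: "deg E v = 1" if "v \<in> V - {c} - {a, x, y}" for v
    using that by (simp add: deg)
  have star_w: "weight E {c, v} = n - 1 + deg E v" if "v \<in> V - {c}" for v
  proof -
    have "c \<noteq> v" using that by auto
    then show ?thesis by (simp add: weight_doubleton degs)
  qed
  have "(\<Sum>e\<in>S. 1 / sqrt (real (weight E e))) = (\<Sum>v\<in>V - {c}. 1 / sqrt (real (n - 1 + deg E v)))"
    unfolding S_def sum_star by (intro sum.cong) (auto simp: star_w)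
  also have "\<dots> = (\<Sum>v\<in>{a, x, y}. 1 / sqrt (real (n - 1 + deg E v)))
      + (real (card (V - {c})) - real (card {a, x, y})) * (1 / sqrt (real n))"
    using assms(1) sub d d' n by (intro sum_except) (auto simp: deg_rest)
  also have "\<dots> = 1 / sqrt (real n + 2) + 2 / sqrt (real n + 1) + (real n - 4) / sqrt (real n)"
    using d d' sub n card by (simp add: degs of_nat_diff add_ac)
  finally have "(\<Sum>e\<in>S. 1 / sqrt (real (weight E e))) = \<dots>" .
  moreover have "chi E = 1 / sqrt (real (weight E {a, x})) + 1 / sqrt (real (weight E {a, y}))
      + (\<Sum>e\<in>S. 1 / sqrt (real (weight E e)))"
    unfolding chi_def using S by (subst (1) E) (simp add: S_def[symmetric])
  moreover have "weight E {a, x} = 5" "weight E {a, y} = 5"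
    using d d' by (auto simp: weight_doubleton degs)
  ultimately show ?thesis by simp
qed

lemma B3_shape_chi:
  assumes "finite V" "card V = n" "B3_shape V E"
  shows "chi E = chi_B3 (real n)"
proof -
  from assms(3) obtain c x y z w where d: "distinct [c, x, y, z, w]" and sub: "{c, x, y, z, w} \<subseteq> V"
    and E: "E = insert {x, y} (insert {z, w} (star (V - {c}) c))"
    unfolding B3_shape_def by (elim exE conjE) (rule that)
  have d': "distinct [w, z, y, x, c]" using d by auto
  define S where "S = star (V - {c}) c"
  have S: "finite S" "{x, y} \<notin> insert {z, w} S" "{z, w} \<notin> S"
    using assms(1) d d' by (auto simp: S_def finite_star doubleton_in_star doubleton_eq_iff)
  have card: "card (V - {c}) = n - 1" using assms sub by simp
  have "card {c, x, y, z, w} \<le> n" using sub assms card_mono by blast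
  then have n: "n \<ge> 5" using d d' by simp
  have deg: "deg E v = (if v = c then n - 1 else of_bool (v \<in> V)) + of_bool (v = z \<or> v = w) + of_bool (v = x \<or> v = y)" for v
    unfolding E using S card by (simp add: S_def[symmetric] deg_insert) (simp add: S_def deg_star)
  have inV: "c \<in> V" "x \<in> V" "y \<in> V" "z \<in> V" "w \<in> V" using sub by auto
  have degs: "deg E c = n - 1" "deg E x = 2" "deg E y = 2" "deg E z = 2" "deg E w = 2"
    using d d' inV by (simp_all add: deg)
  have deg_rest: "deg E v = 1" if "v \<in> V - {c} - {x, y, z, w}" for v
    using that by (simp add: deg)
  have star_w: "weight E {c, v} = n - 1 + deg E v" if "v \<in> V - {c}" for v
  proof -
    have "c \<noteq> v" using that by auto
    then show ?thesis by (simp add: weight_doubleton degs)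
  qed
  have "(\<Sum>e\<in>S. 1 / sqrt (real (weight E e))) = (\<Sum>v\<in>V - {c}. 1 / sqrt (real (n - 1 + deg E v)))"
    unfolding S_def sum_star by (intro sum.cong) (auto simp: star_w)
  also have "\<dots> = (\<Sum>v\<in>{x, y, z, w}. 1 / sqrt (real (n - 1 + deg E v)))
      + (real (card (V - {c})) - real (card {x, y, z, w})) * (1 / sqrt (real n))"
    using assms(1) sub d d' n by (intro sum_except) (auto simp: deg_rest)
  also have "\<dots> = 4 / sqrt (real n + 1) + (real n - 5) / sqrt (real n)"
    using d d' sub n card by (simp add: degs of_nat_diff add_ac)
  finally have "(\<Sum>e\<in>S. 1 / sqrt (real (weight E e))) = \<dots>" .
  moreover have "chi E = 1 / sqrt (real (weight E {x, y})) + 1 / sqrt (real (weight E {z, w}))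
      + (\<Sum>e\<in>S. 1 / sqrt (real (weight E e)))"
    unfolding chi_def using S by (subst (1) E) (simp add: S_def[symmetric])
  moreover have "weight E {x, y} = 4" "weight E {z, w} = 4"
    using d d' by (auto simp: weight_doubleton degs)
  ultimately show ?thesis by (simp add: chi_B3_def)
qed

lemma B4_shape_chi:
  assumes "finite V" "card V = n" "B4_shape V E"
  shows "chi E = 1 / sqrt (real n + 2) + 2 / sqrt (real n) + (real n - 5) / sqrt (real n - 1) +
    2 / sqrt 6 + 1 / sqrt 5"
proof -
  from assms(3) obtain c a x y u where d: "distinct [c, a, x, y, u]" and sub: "{c, a, x, y, u} \<subseteq> V"
    and E: "E = insert {a, x} (insert {a, y} (insert {a, u} (star (V - {c, u}) c)))"
    unfolding B4_shape_def by (elim exE conjE) (rule that)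
  have d': "distinct [u, y, x, a, c]" using d by auto
  define S where "S = star (V - {c, u}) c"
  have S: "finite S" "{a, x} \<notin> insert {a, y} (insert {a, u} S)" "{a, y} \<notin> insert {a, u} S" "{a, u} \<notin> S"
    using assms(1) d d' by (auto simp: S_def finite_star doubleton_in_star doubleton_eq_iff)
  have card: "card (V - {c, u}) = n - 2" using assms sub d d' by (simp add: card_Diff_subset)
  have "card {c, a, x, y, u} \<le> n" using sub assms card_mono by blast
  then have n: "n \<ge> 5" using d d' by simp
  have deg: "deg E v = (if v = c then n - 2 else of_bool (v \<in> V - {u})) + of_bool (v = a \<or> v = u)
      + of_bool (v = a \<or> v = y) + of_bool (v = a \<or> v = x)" for v
    unfolding E using S card by (simp add: S_def[symmetric] deg_insert) (simp add: S_def deg_star)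
  have inV: "c \<in> V" "a \<in> V" "x \<in> V" "y \<in> V" "u \<in> V" using sub by auto
  have degs: "deg E c = n - 2" "deg E a = 4" "deg E x = 2" "deg E y = 2" "deg E u = 1"
    using d d' inV by (simp_all add: deg)
  have deg_rest: "deg E v = 1" if "v \<in> V - {c, u} - {a, x, y}" for v
    using that by (simp add: deg)
  have star_w: "weight E {c, v} = n - 2 + deg E v" if "v \<in> V - {c, u}" for v
  proof -
    have "c \<noteq> v" using that by auto
    then show ?thesis by (simp add: weight_doubleton degs)
  qed
  have "(\<Sum>e\<in>S. 1 / sqrt (real (weight E e))) = (\<Sum>v\<in>V - {c, u}. 1 / sqrt (real (n - 2 + deg E v)))"
    unfolding S_def sum_star by (intro sum.cong) (auto simp: star_w)
  also have "\<dots> = (\<Sum>v\<in>{a, x, y}. 1 / sqrt (real (n - 2 + deg E v)))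
      + (real (card (V - {c, u})) - real (card {a, x, y})) * (1 / sqrt (real n - 1))"
    using assms(1) sub d d' n by (intro sum_except) (auto simp: deg_rest of_nat_diff)
  also have "\<dots> = 1 / sqrt (real n + 2) + 2 / sqrt (real n) + (real n - 5) / sqrt (real n - 1)"
    using d d' sub n card by (simp add: degs of_nat_diff add_ac)
  finally have "(\<Sum>e\<in>S. 1 / sqrt (real (weight E e))) = \<dots>" .
  moreover have "chi E = 1 / sqrt (real (weight E {a, x})) + 1 / sqrt (real (weight E {a, y}))
      + 1 / sqrt (real (weight E {a, u})) + (\<Sum>e\<in>S. 1 / sqrt (real (weight E e)))"
    unfolding chi_def using S by (subst (1) E) (simp add: S_def[symmetric])
  moreover have "weight E {a, x} = 6" "weight E {a, y} = 6" "weight E {a, u} = 5"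
    using d d' by (auto simp: weight_doubleton degs)
  ultimately show ?thesis by simp
qed

lemma P5_shape_chi:
  assumes "P5_shape V E"
  shows "chi E = 3 / sqrt 6 + 2 / sqrt 5 + 1 / 2"
proof -
  from assms obtain l v w x y where d: "distinct [l, v, w, x, y]"
    and E: "E = {{x, y}, {v, x}, {v, y}, {w, x}, {w, y}, {l, v}}"
    unfolding P5_shape_def by (elim exE conjE) (rule that)
  have d': "distinct [y, x, w, v, l]" using d by auto
  have "deg E l = 1" "deg E v = 3" "deg E w = 2" "deg E x = 3" "deg E y = 3"
    unfolding E using d d' by (auto simp: deg_insert deg_empty doubleton_eq_iff)
  then have "weight E {x, y} = 6" "weight E {v, x} = 6" "weight E {v, y} = 6"
    "weight E {w, x} = 5" "weight E {w, y} = 5" "weight E {l, v} = 4"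
    using d d' by (auto simp: weight_doubleton)
  moreover have "chi E = (\<Sum>e\<in>{{x, y}, {v, x}, {v, y}, {w, x}, {w, y}, {l, v}}. 1 / sqrt (real (weight E e)))"
    unfolding chi_def using E by simp
  ultimately show ?thesis using d d' by (simp add: doubleton_eq_iff)
qed

section \<open>The named graphs realise the shapes\<close>

lemma uedges_ugraph: "uedges (ugraph V R) = (\<lambda>(u, v). {u, v}) ` R"
  by (auto simp: uedges_def ugraph_def image_Un insert_commute intro: rev_image_eqI)

lemma pair_graph_ugraph:
  assumes "finite V" "R \<subseteq> V \<times> V" "\<And>u. (u, u) \<notin> R"
  shows "pair_graph (ugraph V R)"
proof
  show "fst e \<in> pverts (ugraph V R)" "snd e \<in> pverts (ugraph V R)" if "e \<in> parcs (ugraph V R)" for e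
    using that assms(2) by (auto simp: ugraph_def)
  show "finite (pverts (ugraph V R))" using assms(1) by (simp add: ugraph_def)
  have "finite R" using assms(1,2) by (meson finite_SigmaI finite_subset)
  then show "finite (parcs (ugraph V R))" by (simp add: ugraph_def)
  show "fst e \<noteq> snd e" if "e \<in> parcs (ugraph V R)" for e
    using that assms(3) by (cases e) (auto simp: ugraph_def)
  show "symmetric (with_proj (ugraph V R))"
    by (auto simp: symmetric_def ugraph_def sym_def)
qed

text \<open>Vertex sets are kept as initial segments, so the successor of the maximum is the first
  fresh vertex and attachments can be iterated, as in \<open>B_graph\<close>.\<close>

lemma attach_pendents:
  assumes G: "pair_graph G" and V: "pverts G = {0..<m}" and v: "v < m"
  shows "pair_graph (attach_pendents G v k)"
    and "pverts (attach_pendents G v k) = {0..<m + k}"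
    and "uedges (attach_pendents G v k) = uedges G \<union> star {m..<m + k} v"
proof -
  interpret pair_graph G by fact
  have "Max {0..<m} = m - 1" using v by (intro Max_eqI) auto
  then have m: "Suc (Max (pverts G)) = m" using v V by simp
  then have eq: "attach_pendents G v k = ugraph {0..<m + k} (parcs G \<union> {v} \<times> {m..<m + k})"
    unfolding attach_pendents_def Let_def m V by (simp add: ivl_disj_un)
  have "parcs G \<subseteq> {0..<m} \<times> {0..<m}"
    using in_arcsD1 in_arcsD2 V by auto
  moreover have "(u, u) \<notin> parcs G" for u using no_loops' by blast
  ultimately show "pair_graph (attach_pendents G v k)"
    unfolding eq using v by (intro pair_graph_ugraph) auto
  show "pverts (attach_pendents G v k) = {0..<m + k}"
    unfolding eq by (simp add: ugraph_def)
  show "uedges (attach_pendents G v k) = uedges G \<union> star {m..<m + k} v"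
    unfolding eq uedges_ugraph image_Un by (auto simp: uedges_def star_def)
qed

lemma K4_minus_e:
  "pair_graph K4_minus_e" "pverts K4_minus_e = {0..<4}"
  "uedges K4_minus_e = {{0, 1}, {0, 2}, {0, 3}, {1, 2}, {1, 3}}"
  unfolding K4_minus_e_def
  by (auto simp: uedges_ugraph intro!: pair_graph_ugraph) (auto simp: ugraph_def)

lemma two_triangles:
  "pair_graph two_triangles" "pverts two_triangles = {0..<5}"
  "uedges two_triangles = {{0, 1}, {0, 2}, {1, 2}, {0, 3}, {0, 4}, {3, 4}}"
  unfolding two_triangles_def
  by (auto simp: uedges_ugraph intro!: pair_graph_ugraph) (auto simp: ugraph_def)

lemma B_graph:
  assumes "a \<ge> 3" "b \<ge> 3"
  shows "pair_graph (B_graph a b)" "pverts (B_graph a b) = {0..<a + b - 2}"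
    and "uedges (B_graph a b) = {{0, 1}, {0, 2}, {0, 3}, {1, 2}, {1, 3}} \<union>
      star {4..<a + 1} 0 \<union> star {a + 1..<a + b - 2} 1"
proof -
  let ?G = "attach_pendents K4_minus_e 0 (a - 3)"
  have eqs: "4 + (a - 3) = a + 1" "a + 1 + (b - 3) = a + b - 2" using assms by auto
  note 1 = attach_pendents[OF K4_minus_e(1,2), of 0 "a - 3", unfolded eqs(1)]
  note 2 = attach_pendents[of ?G "a + 1" 1 "b - 3", unfolded eqs(2)]
  show "pair_graph (B_graph a b)" "pverts (B_graph a b) = {0..<a + b - 2}"
    "uedges (B_graph a b) = {{0, 1}, {0, 2}, {0, 3}, {1, 2}, {1, 3}} \<union>
      star {4..<a + 1} 0 \<union> star {a + 1..<a + b - 2} 1"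
    unfolding B_graph_def using 1 2 assms by (simp_all add: K4_minus_e)
qed

lemma M_shape_B_graph:
  assumes "n \<ge> 4"
  shows "pair_graph (B_graph (n - 1) 3)" "pverts (B_graph (n - 1) 3) = {0..<n}"
    and "M_shape {0..<n} (uedges (B_graph (n - 1) 3))"
proof -
  have eqs: "n - 1 + 3 - 2 = n" "n - 1 + 1 = n" using assms by auto
  note B = B_graph[of "n - 1" 3, unfolded eqs]
  show "pair_graph (B_graph (n - 1) 3)" "pverts (B_graph (n - 1) 3) = {0..<n}"
    using B assms by auto
  have "{0..<n} - {0} = insert 1 (insert 2 (insert 3 {4..<n}))" using assms by auto
  then have "star ({0..<n} - {0}) 0 = insert {0, 1} (insert {0, 2} (insert {0, 3} (star {4..<n} 0)))"
    by (simp add: star_insert)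
  then have "uedges (B_graph (n - 1) 3) = insert {1, 2} (insert {1, 3} (star ({0..<n} - {0}) 0))"
    using B(3) assms by (auto simp: star_empty)
  moreover have "distinct [0::nat, 1, 2, 3]" "{0, 1, 2, 3} \<subseteq> {0..<n}"
    using assms by auto
  ultimately show "M_shape {0..<n} (uedges (B_graph (n - 1) 3))"
    unfolding M_shape_def by (intro exI[of _ 0] exI[of _ 1] exI[of _ 2] exI[of _ 3] conjI)
qed

lemma B4_shape_B_graph:
  assumes "n \<ge> 6"
  shows "pair_graph (B_graph (n - 2) 4)" "pverts (B_graph (n - 2) 4) = {0..<n}"
    and "B4_shape {0..<n} (uedges (B_graph (n - 2) 4))"
proof -
  have eqs: "n - 2 + 4 - 2 = n" "n - 2 + 1 = n - 1" using assms by auto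
  note B = B_graph[of "n - 2" 4, unfolded eqs]
  show "pair_graph (B_graph (n - 2) 4)" "pverts (B_graph (n - 2) 4) = {0..<n}"
    using B assms by auto
  \<comment> \<open>The vertex \<open>n - 1\<close> is attached last; it is the pendent neighbour of
    vertex 1 and the only vertex other than 0 missing from the star at 0.\<close>
  define m where "m = n - 1"
  have "{0..<n} - {0, m} = insert 1 (insert 2 (insert 3 {4..<m}))" "{m..<n} = {m}"
    using assms by (auto simp: m_def)
  then have "star ({0..<n} - {0, m}) 0 = insert {0, 1} (insert {0, 2} (insert {0, 3} (star {4..<m} 0)))"
    and "star {m..<n} 1 = {{1, m}}"
    by (simp_all add: star_insert star_empty)
  then have "uedges (B_graph (n - 2) 4)
      = insert {1, 2} (insert {1, 3} (insert {1, m} (star ({0..<n} - {0, m}) 0)))"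
    using B(3) assms unfolding m_def[symmetric] by auto
  moreover have "distinct [0::nat, 1, 2, 3, m]" "{0, 1, 2, 3, m} \<subseteq> {0..<n}"
    using assms by (auto simp: m_def)
  ultimately show "B4_shape {0..<n} (uedges (B_graph (n - 2) 4))"
    unfolding B4_shape_def by (intro exI[of _ 0] exI[of _ 1] exI[of _ 2] exI[of _ 3] exI[of _ m] conjI)
qed

lemma B3_shape_B3_graph:
  assumes "n \<ge> 5"
  shows "pair_graph (B3_graph n)" "pverts (B3_graph n) = {0..<n}"
    and "B3_shape {0..<n} (uedges (B3_graph n))"
proof -
  have eqs: "5 + (n - 5) = n" using assms by auto
  note B = attach_pendents[OF two_triangles(1,2), of 0 "n - 5", unfolded eqs, folded B3_graph_def]
  show "pair_graph (B3_graph n)" "pverts (B3_graph n) = {0..<n}" using B by auto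
  have "{0..<n} - {0} = insert 1 (insert 2 (insert 3 (insert 4 {5..<n})))" using assms by auto
  then have "star ({0..<n} - {0}) 0
      = insert {0, 1} (insert {0, 2} (insert {0, 3} (insert {0, 4} (star {5..<n} 0))))"
    by (simp add: star_insert)
  then have "uedges (B3_graph n) = insert {1, 2} (insert {3, 4} (star ({0..<n} - {0}) 0))"
    using B(3) by (auto simp: two_triangles)
  moreover have "distinct [0::nat, 1, 2, 3, 4]" "{0, 1, 2, 3, 4} \<subseteq> {0..<n}"
    using assms by auto
  ultimately show "B3_shape {0..<n} (uedges (B3_graph n))"
    unfolding B3_shape_def by (intro exI[of _ 0] exI[of _ 1] exI[of _ 2] exI[of _ 3] exI[of _ 4] conjI)
qed

lemma P5_shape_attach_pendents:
  defines "G \<equiv> attach_pendents K4_minus_e 2 1"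
  shows "pair_graph G" "pverts G = {0..<5}" "P5_shape {0..<5} (uedges G)"
proof -
  note B = attach_pendents[OF K4_minus_e(1,2), of 2 1, folded G_def]
  show "pair_graph G" "pverts G = {0..<5}" using B by auto
  have "{4..<5::nat} = {4}" by auto
  then have "uedges G = {{0, 1}, {2, 0}, {2, 1}, {3, 0}, {3, 1}, {4, 2}}"
    using B(3) by (simp add: K4_minus_e star_insert star_empty) (auto simp: insert_commute)
  moreover have "distinct [4, 2, 3, 0, 1::nat]" "{0..<5} = {4, 2, 3, 0, 1::nat}" by auto
  \<comment> \<open>The leaf 4 hangs at 2, the vertex 3 is the other one of degree two in
    \<open>K4_minus_e\<close>, and 0 and 1 are those of degree three.\<close>
  ultimately show "P5_shape {0..<5} (uedges G)"
    unfolding P5_shape_def by (intro exI[of _ 4] exI[of _ 2] exI[of _ 3] exI[of _ 0] exI[of _ 1] conjI)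
qed

section \<open>The shapes are bicyclic\<close>

lemma bicyclicI:
  assumes G: "pair_graph G" and "card (pverts G) = n" "card (uedges G) = n + 1" "c \<in> pverts G"
    and nbr: "\<And>v. v \<in> pverts G \<Longrightarrow> v = c \<or> {c, v} \<in> uedges G \<or> (\<exists>a. {c, a} \<in> uedges G \<and> {a, v} \<in> uedges G)"
  shows "bicyclic n G"
proof -
  interpret pair_graph G by fact
  have "c \<rightarrow>\<^sup>*\<^bsub>with_proj G\<^esub> v" if v: "v \<in> pverts G" for v
  proof -
    \<comment> \<open>Every shape has a vertex at distance at most two from all others, so walks of
      length at most two suffice for connectedness.\<close>
    consider "v = c" | "(c, v) \<in> parcs G" | a where "(c, a) \<in> parcs G" "(a, v) \<in> parcs G"
      using nbr[OF v] parcs_iff_uedges[OF G] by blast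
    then show ?thesis
    proof cases
      case 1
      then show ?thesis using v by simp
    next
      case 2
      then show ?thesis by (intro reachable_adjI) simp
    next
      case 3
      then have "c \<rightarrow>\<^sup>*\<^bsub>with_proj G\<^esub> a" by (intro reachable_adjI) simp
      then show ?thesis using 3 by (intro reachable_adj_trans[of c a v]) simp_all
    qed
  qed
  then show ?thesis
    using assms pair_graph_connectedI[OF G assms(4)] by (simp add: bicyclic_def)
qed

lemma M_shape_bicyclic:
  assumes G: "pair_graph G" and "M_shape (pverts G) (uedges G)"
  shows "bicyclic (card (pverts G)) G"
proof -
  let ?V = "pverts G"
  from assms(2) obtain c a x y where d: "distinct [c, a, x, y]" and sub: "{c, a, x, y} \<subseteq> ?V"
    and E: "uedges G = insert {a, x} (insert {a, y} (star (?V - {c}) c))"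
    unfolding M_shape_def by (elim exE conjE) (rule that)
  have fin: "finite ?V" using G by (rule pair_graph_finite)
  have "card ?V > 0" using fin sub by (auto simp: card_gt_0_iff)
  moreover have "{a, x} \<notin> insert {a, y} (star (?V - {c}) c)" "{a, y} \<notin> star (?V - {c}) c"
    using d by (auto simp: doubleton_in_star doubleton_eq_iff)
  ultimately have "card (uedges G) = card ?V + 1"
    unfolding E using fin sub by (simp add: finite_star card_star)
  then show ?thesis
    using sub by (intro bicyclicI[of G _ c] G) (auto simp: E doubleton_in_star)
qed

lemma B3_shape_bicyclic:
  assumes G: "pair_graph G" and "B3_shape (pverts G) (uedges G)"
  shows "bicyclic (card (pverts G)) G"
proof -
  let ?V = "pverts G"
  from assms(2) obtain c x y z w where d: "distinct [c, x, y, z, w]" and sub: "{c, x, y, z, w} \<subseteq> ?V"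
    and E: "uedges G = insert {x, y} (insert {z, w} (star (?V - {c}) c))"
    unfolding B3_shape_def by (elim exE conjE) (rule that)
  have fin: "finite ?V" using G by (rule pair_graph_finite)
  have "card ?V > 0" using fin sub by (auto simp: card_gt_0_iff)
  moreover have "{x, y} \<notin> insert {z, w} (star (?V - {c}) c)" "{z, w} \<notin> star (?V - {c}) c"
    using d by (auto simp: doubleton_in_star doubleton_eq_iff)
  ultimately have "card (uedges G) = card ?V + 1"
    unfolding E using fin sub by (simp add: finite_star card_star)
  then show ?thesis
    using sub by (intro bicyclicI[of G _ c] G) (auto simp: E doubleton_in_star)
qed

lemma B4_shape_bicyclic:
  assumes G: "pair_graph G" and "B4_shape (pverts G) (uedges G)"
  shows "bicyclic (card (pverts G)) G"
proof -
  let ?V = "pverts G"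
  from assms(2) obtain c a x y f where d: "distinct [c, a, x, y, f]" and sub: "{c, a, x, y, f} \<subseteq> ?V"
    and E: "uedges G = insert {a, x} (insert {a, y} (insert {a, f} (star (?V - {c, f}) c)))"
    unfolding B4_shape_def by (elim exE conjE) (rule that)
  have fin: "finite ?V" using G by (rule pair_graph_finite)
  have "card {c, f} \<le> card ?V" using fin sub by (intro card_mono) auto
  then have "card ?V \<ge> 2" using d by simp
  moreover have "card (?V - {c, f}) = card ?V - 2"
    using fin sub d by (simp add: card_Diff_subset)
  moreover have "{a, x} \<notin> insert {a, y} (insert {a, f} (star (?V - {c, f}) c))"
    "{a, y} \<notin> insert {a, f} (star (?V - {c, f}) c)" "{a, f} \<notin> star (?V - {c, f}) c"
    using d by (auto simp: doubleton_in_star doubleton_eq_iff)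
  ultimately have card: "card (uedges G) = card ?V + 1"
    unfolding E using fin by (simp add: finite_star card_star)
  have edges: "{c, a} \<in> uedges G" "{a, f} \<in> uedges G"
    using d sub by (auto simp: E doubleton_in_star)
  show ?thesis
  proof (rule bicyclicI[OF G refl card])
    show "c \<in> ?V" using sub by simp
    fix v assume "v \<in> ?V"
    then have "v = c \<or> v = f \<or> {c, v} \<in> uedges G"
      by (simp add: E doubleton_in_star) blast
    then show "v = c \<or> {c, v} \<in> uedges G \<or> (\<exists>a. {c, a} \<in> uedges G \<and> {a, v} \<in> uedges G)"
      using edges by blast
  qed
qed

lemma P5_shape_bicyclic:
  assumes G: "pair_graph G" and "P5_shape (pverts G) (uedges G)"
  shows "bicyclic 5 G"
proof -
  from assms(2) obtain l v w x y where d: "distinct [l, v, w, x, y]" and V: "pverts G = {l, v, w, x, y}"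
    and E: "uedges G = {{x, y}, {v, x}, {v, y}, {w, x}, {w, y}, {l, v}}"
    unfolding P5_shape_def by (elim exE conjE) (rule that)
  have d': "distinct [y, x, w, v, l]" using d by auto
  have "card (uedges G) = 5 + 1" "card (pverts G) = 5"
    using d d' by (simp_all add: E V doubleton_eq_iff)
  \<comment> \<open>The vertex \<open>x\<close> serves as the centre: it is adjacent to
    \<open>v\<close>, \<open>w\<close> and \<open>y\<close>, and \<open>l\<close> is reached through
    \<open>v\<close>.\<close>
  moreover have "{x, v} \<in> uedges G" "{v, l} \<in> uedges G" "{x, y} \<in> uedges G" "{x, w} \<in> uedges G"
    by (simp_all add: E insert_commute)
  moreover from this have "u = x \<or> {x, u} \<in> uedges G \<or> (\<exists>a. {x, a} \<in> uedges G \<and> {a, u} \<in> uedges G)"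
    if "u \<in> pverts G" for u using that unfolding V by blast
  moreover have "x \<in> pverts G" using V by simp
  ultimately show ?thesis
    by (intro bicyclicI[OF G])
qed

section \<open>Graphs that are not extremal\<close>

definition chi_B4 :: "real \<Rightarrow> real" where
  "chi_B4 x = 1 / sqrt (x + 2) + 2 / sqrt x + (x - 5) / sqrt (x - 1) + 2 / sqrt 6 + 1 / sqrt 5"

text \<open>Each right side is a competitor in \<open>trichotomy_6_7\<close>: the case
  \<open>k = 0\<close>, Jensen's bound 7 / (12/5) for \<open>n = 6\<close> and 8 / (5/2) for
  \<open>n = 7\<close>, and for \<open>k = 1\<close> the star bound plus the bound of
  \<open>one_far_shape\<close>.\<close>

lemma chi_B4_6_7:
  "chi_B4 6 < chi_B3 6" "chi_B4 7 < chi_B3 7"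
  "chi_B4 6 < 35 / 12" "chi_B4 7 < 16 / 5"
  "chi_B4 6 < 8 / 5 + (1 / sqrt 6 + 2 / sqrt 5)" "chi_B4 7 < 5 / sqrt 7 + (1 / sqrt 6 + 2 / sqrt 5)"
  using sqrt_bounds by (simp_all add: chi_B4_def chi_B3_def sqrt_nine divide_sqrt)

context bicyclic_edges
begin

lemma other_endpoint:
  assumes "e \<in> E" "a \<in> e"
  obtains x where "e = {a, x}" "x \<noteq> a" "x \<in> V"
proof -
  obtain u v where "e = {u, v}" "u \<noteq> v" "u \<in> V" "v \<in> V" using edgeE[OF assms(1)] by blast
  then show ?thesis using that[of u] that[of v] assms(2) by (auto simp: insert_commute)
qed

lemma deg_less:
  assumes "v \<in> V"
  shows "deg E v + 1 \<le> n"
proof -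
  have "{e \<in> E. v \<in> e} \<subseteq> star (V - {v}) v"
  proof
    fix e assume "e \<in> {e \<in> E. v \<in> e}"
    then obtain x where "e = {v, x}" "x \<noteq> v" "x \<in> V" by (auto elim: other_endpoint)
    then show "e \<in> star (V - {v}) v" by (simp add: doubleton_in_star)
  qed
  then have "deg E v \<le> card (star (V - {v}) v)"
    unfolding deg_def using finite_V by (intro card_mono finite_star) auto
  also have "\<dots> = n - 1" using assms finite_V card_V by (simp add: card_star)
  finally have "deg E v \<le> n - 1" .
  moreover have "n > 0" using assms finite_V card_V card_gt_0_iff by blast
  ultimately show ?thesis by linarith
qed

text \<open>The degree sum 2(n + 1) exceeds 2n, so the maximum degree is at least three. This keeps
  the case splits for small \<open>n\<close> short.\<close>

lemma exists_max_center:
  assumes "n \<ge> 2"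
  obtains c k where "bicyclic_center V E n c k" "\<And>v. v \<in> V \<Longrightarrow> deg E v \<le> deg E c" "deg E c \<ge> 3"
proof -
  have "V \<noteq> {}" using assms card_V by auto
  then obtain c where c: "c \<in> V" "\<forall>v\<in>V. deg E v \<le> deg E c"
    using finite_V obtains_MAX[of V "deg E"] by (metis Max_ge finite_imageI imageI)
  have "2 * (n + 1) \<le> n * deg E c"
    using sum_bounded_above[of V "deg E" "deg E c"] c(2) card_V unfolding sum_deg by simp
  moreover have "n * deg E c \<le> n * 2" if "deg E c \<le> 2" using that by (rule mult_le_mono2)
  ultimately have "\<not> deg E c \<le> 2" by fastforce
  moreover have "bicyclic_center V E n c (n - (deg E c + 1))"
    using deg_less[OF c(1)] c(1) by unfold_locales auto
  ultimately show ?thesis using that c(2) by auto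
qed

text \<open>The general bound gives 52, and each vertex of degree 2 or 3 improves it by 2. If there
  were none, the counts would force four leaves and three vertices of degree four, allowing at most
  4 + 3 = 7 edges instead of 8. The value 50 makes the mean weight 25/4, a perfect square.\<close>

lemma sum_deg_sq_le_50:
  assumes n: "n = 7" and max: "\<And>v. v \<in> V \<Longrightarrow> deg E v \<le> 4"
  shows "(\<Sum>v\<in>V. (deg E v)\<^sup>2) \<le> 50"
proof -
  let ?f = "\<lambda>v. (int (deg E v) - 1) * (4 - int (deg E v))"
  have d: "deg E v \<in> {1, 2, 3, 4}" if "v \<in> V" for v
    using that n max[OF that] deg_pos[of v] by auto
  have f: "?f v \<ge> 0" if "v \<in> V" for v using d[OF that] by auto
  have "\<exists>v\<in>V. deg E v \<in> {2, 3}"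
  proof (rule ccontr)
    assume no: "\<not> (\<exists>v\<in>V. deg E v \<in> {2, 3})"
    define L B where "L = {v \<in> V. deg E v = 1}" and "B = {v \<in> V. deg E v = 4}"
    have LB: "V = L \<union> B" "L \<inter> B = {}" "finite L" "finite B"
      using no d finite_V by (auto simp: L_def B_def)
    have "card L + card B = 7"
      using card_Un_disjoint[of L B] LB card_V n by simp
    moreover have sumL: "(\<Sum>v\<in>L. deg E v) = card L" by (simp add: L_def)
    moreover have "(\<Sum>v\<in>B. deg E v) = 4 * card B" by (simp add: B_def)
    moreover have "(\<Sum>v\<in>L. deg E v) + (\<Sum>v\<in>B. deg E v) = 16"
      using sum.union_disjoint[of L B "deg E"] LB sum_deg n by simp
    ultimately have "card B = 3" "card L = 4" by linarith+
    have "E \<subseteq> (\<Union>v\<in>L. {e \<in> E. v \<in> e}) \<union> {e. e \<subseteq> B \<and> card e = 2}"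
      using edge_subset card_edge LB(1) by blast
    then have "card E \<le> card ((\<Union>v\<in>L. {e \<in> E. v \<in> e}) \<union> {e. e \<subseteq> B \<and> card e = 2})"
      using LB finite_E by (intro card_mono) auto
    also have "\<dots> \<le> card (\<Union>v\<in>L. {e \<in> E. v \<in> e}) + card {e. e \<subseteq> B \<and> card e = 2}"
      by (rule card_Un_le)
    also have "\<dots> \<le> (\<Sum>v\<in>L. card {e \<in> E. v \<in> e}) + card {e. e \<subseteq> B \<and> card e = 2}"
      using LB by (intro add_right_mono card_UN_le)
    also have "\<dots> = 4 + (3 choose 2)"
      using sumL \<open>card L = 4\<close> \<open>card B = 3\<close> n_subsets[OF LB(4), of 2] by (simp add: deg_def)
    also have "\<dots> = 7" by (simp add: choose_two)
    finally show False using card_E n by simp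
  qed
  then obtain v where v: "v \<in> V" "deg E v = 2 \<or> deg E v = 3" by blast
  then have "2 = ?f v" by auto
  also have "\<dots> \<le> (\<Sum>v\<in>V. ?f v)"
    using f by (intro member_le_sum v finite_V) auto
  finally have "2 \<le> (4 + 1) * (int n + 2) + int n - int (\<Sum>v\<in>V. (deg E v)\<^sup>2)"
    by (simp only: sum_deg_sq_eq)
  then have "int (\<Sum>v\<in>V. (deg E v)\<^sup>2) \<le> int 50" unfolding n by simp
  then show ?thesis by (simp only: of_nat_le_iff)
qed

text \<open>Without leaves all degrees are 2 or 3, which determines the sum of squares and makes the
  mean weight 5. If there is a leaf, removing it leaves five edges on four vertices, a complete
  graph minus one edge \<open>m\<close>; the degree bound forces the neighbour of the leaf to lie on
  \<open>m\<close>.\<close>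

lemma P5_shape_or_chi_ge:
  assumes n: "n = 5" and max: "\<And>v. v \<in> V \<Longrightarrow> deg E v \<le> 3"
  shows "P5_shape V E \<or> chi E \<ge> 6 / sqrt 5"
proof (cases "\<exists>l\<in>V. deg E l = 1")
  case False
  have "(deg E v)\<^sup>2 + 6 = 5 * deg E v" if "v \<in> V" for v
  proof -
    have "deg E v = 2 \<or> deg E v = 3" using that n max[OF that] deg_pos[of v] False by force
    then show ?thesis by auto
  qed
  then have "(\<Sum>v\<in>V. (deg E v)\<^sup>2 + 6) = (\<Sum>v\<in>V. 5 * deg E v)" by simp
  then have "(\<Sum>v\<in>V. (deg E v)\<^sup>2) = 30"
    using card_V n sum_deg by (simp add: sum.distrib sum_distrib_left[symmetric])
  then show ?thesis using chi_ge_jensen[of 5] n by simp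
next
  case True
  then obtain l where l: "l \<in> V" "deg E l = 1" by blast
  then obtain e where e: "{e \<in> E. l \<in> e} = {e}"
    unfolding deg_def by (elim card_1_singletonE)
  then obtain v where v: "e = {l, v}" "v \<noteq> l" "v \<in> V"
    using other_endpoint[of e l] by blast
  let ?P = "{e. e \<subseteq> V - {l} \<and> card e = 2}"
  have fin: "finite (V - {l})" using finite_V by simp
  have "card (V - {l}) = 4" using l card_V finite_V n by simp
  then have P: "finite ?P" "card ?P = 6"
    using n_subsets[OF fin, of 2] fin by (simp_all add: choose_two)
  have "e \<in> {e \<in> E. l \<in> e}" unfolding e by simp
  then have "e \<in> E" by simp
  have sub: "E - {e} \<subseteq> ?P"
  proof
    fix e' assume e': "e' \<in> E - {e}"
    then have "l \<notin> e'" using e by auto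
    then show "e' \<in> ?P" using e' edge_subset[of e'] card_edge[of e'] by auto
  qed
  then have "card (?P - (E - {e})) = 1"
    using P sub card_E n finite_E \<open>e \<in> E\<close> by (simp add: card_Diff_subset)
  then obtain m where m: "?P - (E - {e}) = {m}" by (rule card_1_singletonE)
  then have mP: "m \<in> ?P" by blast
  have inE: "e' \<in> E" if "e' \<in> ?P" "e' \<noteq> m" for e' using that m by blast
  have "v \<in> m"
  proof (rule ccontr)
    \<comment> \<open>Otherwise \<open>v\<close> would be joined to the other three vertices as well
      as to the leaf, and would have degree four.\<close>
    assume "v \<notin> m"
    have "card (V - {l, v}) = 3" using l v card_V finite_V n by (simp add: card_Diff_subset)
    have "insert e (star (V - {l, v}) v) \<subseteq> {e \<in> E. v \<in> e}"
    proof -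
      have "{v, u} \<in> E" if "u \<in> V - {l, v}" for u
        using that v \<open>v \<notin> m\<close> by (intro inE) auto
      then show ?thesis using v \<open>e \<in> E\<close> by (auto simp: star_def)
    qed
    then have "card (insert e (star (V - {l, v}) v)) \<le> deg E v"
      unfolding deg_def using finite_E by (intro card_mono) auto
    moreover have "e \<notin> star (V - {l, v}) v" using v by (auto simp: doubleton_in_star)
    ultimately have "4 \<le> deg E v"
      using \<open>card (V - {l, v}) = 3\<close> finite_V by (simp add: finite_star card_star)
    then show False using max[OF v(3)] by simp
  qed
  then obtain w where w: "m = {v, w}" "w \<noteq> v" "w \<in> V - {l}"
  proof -
    obtain p q where "m = {p, q}" "p \<noteq> q" using mP by (auto simp: card_2_iff)
    then show ?thesis using \<open>v \<in> m\<close> mP that[of p] that[of q] by (auto simp: insert_commute)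
  qed
  have "distinct [l, v, w]" using v w by auto
  then have "card {l, v, w} = 3" by simp
  then have "card (V - {l, v, w}) = 2"
    using l v w card_V finite_V n by (simp add: card_Diff_subset)
  then obtain x y where xy: "V - {l, v, w} = {x, y}" "x \<noteq> y" unfolding card_2_iff by blast
  have V: "V = {l, v, w, x, y}" using xy l v w by blast
  have d: "distinct [l, v, w, x, y]" using xy v w by auto
  have pair: "{p, q} \<in> E" if "p \<in> V - {l}" "q \<in> V - {l}" "p \<noteq> q" "q \<notin> m" for p q
    using that by (intro inE) auto
  have "x \<notin> m" "y \<notin> m" "v \<in> V - {l}" "w \<in> V - {l}" "x \<in> V - {l}" "y \<in> V - {l}"
    using d unfolding V w(1) by auto
  moreover have "x \<noteq> y" "v \<noteq> x" "v \<noteq> y" "w \<noteq> x" "w \<noteq> y" using d by auto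
  ultimately have "{{x, y}, {v, x}, {v, y}, {w, x}, {w, y}} \<subseteq> E"
    using pair by simp
  then have "{{x, y}, {v, x}, {v, y}, {w, x}, {w, y}, {l, v}} \<subseteq> E"
    using \<open>e \<in> E\<close> v(1) by auto
  moreover have "card {{x, y}, {v, x}, {v, y}, {w, x}, {w, y}, {l, v}} = card E"
  proof -
    have "distinct [y, x, w, v, l]" using d by auto
    then show ?thesis using d card_E n by (simp add: doubleton_eq_iff)
  qed
  ultimately have "E = {{x, y}, {v, x}, {v, y}, {w, x}, {w, y}, {l, v}}"
    using card_subset_eq[OF finite_E] by metis
  then have "P5_shape V E" unfolding P5_shape_def using d V by (intro exI conjI)
  then show ?thesis ..
qed

end

section \<open>Centres with few or many non-neighbours\<close>

context bicyclic_center
begin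

lemma E_eq: "E = star nbrs c \<union> outer"
  using E_split(1) star_edges by (simp add: star_def)

lemma outer_subset:
  assumes "e \<in> outer"
  shows "e \<subseteq> V - {c}"
  using assms edge_subset by (auto simp: outer_def)

lemma no_far_shape:
  assumes k: "k = 0"
  shows "M_shape V E \<or> B3_shape V E"
proof -
  have "far = {}" using card_far k finite_V by (simp add: far_def)
  then have nbrs: "nbrs = V - {c}" using nbrs_subset by (auto simp: far_def)
  have "card outer = 2" using card_outer k by simp
  then obtain e1 e2 where e: "outer = {e1, e2}" "e1 \<noteq> e2"
    unfolding card_2_iff by blast
  then have E: "E = insert e1 (insert e2 (star (V - {c}) c))" using E_eq nbrs by auto
  have sub: "e1 \<subseteq> V - {c}" "e2 \<subseteq> V - {c}" "e1 \<in> E" "e2 \<in> E" using e outer_subset by (auto simp: E)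
  show ?thesis
  proof (cases "e1 \<inter> e2 = {}")
    case True
    obtain x y z w where "e1 = {x, y}" "x \<noteq> y" "e2 = {z, w}" "z \<noteq> w"
      using edgeE sub(3,4) by metis
    moreover from this have "distinct [c, x, y, z, w]" "{c, x, y, z, w} \<subseteq> V"
      using sub True c_in by auto
    ultimately have "B3_shape V E"
      unfolding B3_shape_def using E by (intro exI conjI) auto
    then show ?thesis ..
  next
    case False
    then obtain a where "a \<in> e1" "a \<in> e2" by blast
    then obtain x y where xy: "e1 = {a, x}" "x \<noteq> a" "e2 = {a, y}" "y \<noteq> a"
      using other_endpoint sub(3,4) by metis
    then have "distinct [c, a, x, y]" "{c, a, x, y} \<subseteq> V"
      using sub e(2) c_in by auto
    with xy have "M_shape V E"
      unfolding M_shape_def using E by (intro exI conjI) auto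
    then show ?thesis ..
  qed
qed

text \<open>The equality case of \<open>weight_outer_bounds\<close>: weight \<open>k + 5\<close> is
  attained only if both ends are neighbours of \<open>c\<close> and every outer edge meets
  \<open>e\<close>.\<close>

lemma max_weight_outer:
  assumes "e \<in> outer" "weight E e \<ge> k + 5"
  shows "e \<inter> far = {}" "e' \<in> outer \<Longrightarrow> e' \<inter> e \<noteq> {}"
proof -
  have "e \<in> E" using assms by (simp add: outer_def)
  then show "e \<inter> far = {}"
    using weight_outer_bounds(2)[OF assms(1)] assms(2) by (auto simp: far_edges_def)
  have "card {e' \<in> outer. e' \<inter> e \<noteq> {}} \<ge> card outer"
    using weight_outer_le[OF assms(1)] assms(2) card_edge_Int_nbrs(1)[OF \<open>e \<in> E\<close>] card_outer by linarith
  then have "{e' \<in> outer. e' \<inter> e \<noteq> {}} = outer"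
    using finite_outer by (intro card_seteq) auto
  then show "e' \<in> outer \<Longrightarrow> e' \<inter> e \<noteq> {}" by blast
qed

text \<open>There are three outer edges, and the one at the far vertex \<open>f\<close> has weight
  at most 5. If both others have weight at least 6, each meets \<open>{a, f}\<close> but avoids
  \<open>f\<close>, hence passes through \<open>a\<close>, which is the shape of
  \<open>B_n(n-2,4)\<close>. Otherwise a second edge has weight at most 5.\<close>

lemma one_far_shape:
  assumes k: "k = 1"
  shows "B4_shape V E \<or> (\<Sum>e\<in>outer. 1 / sqrt (real (weight E e))) \<ge> 1 / sqrt 6 + 2 / sqrt 5"
proof -
  have "card far = 1" using card_far k by simp
  then obtain f where f: "far = {f}" by (rule card_1_singletonE)
  then have fV: "f \<in> V" "f \<noteq> c" by (auto simp: far_def)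
  have nbrs: "nbrs = V - {c, f}" using f nbrs_subset by (auto simp: far_def)
  have "{f} \<noteq> V" using c_in fV by auto
  then obtain a where a: "a \<in> V" "a \<noteq> f" "{f, a} \<in> E"
    using cut[of "{f}"] fV by auto
  have af: "{a, f} \<in> E" using a(3) by (simp add: insert_commute)
  have "a \<noteq> c"
  proof
    assume "a = c"
    then have "f \<in> nbrs" using af by (simp add: nbrs_def)
    then show False using nbrs by simp
  qed
  have e1: "{a, f} \<in> outer" "{a, f} \<in> far_edges"
    using af \<open>a \<noteq> c\<close> fV f by (auto simp: outer_def far_edges_def)
  have "card (outer - {{a, f}}) = 2"
    using card_outer k e1 finite_outer by simp
  then obtain e2 e3 where e23: "outer - {{a, f}} = {e2, e3}" "e2 \<noteq> e3"
    unfolding card_2_iff by blast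
  have "outer = insert {a, f} (outer - {{a, f}})" using e1 by blast
  then have outer: "outer = {{a, f}, e2, e3}" unfolding e23(1) .
  have "{a, f} \<notin> {e2, e3}" unfolding e23(1)[symmetric] by simp
  then have outer_distinct: "e2 \<noteq> {a, f}" "e3 \<noteq> {a, f}" by auto
  let ?r = "\<lambda>e. 1 / sqrt (real (weight E e))"
  have split: "(\<Sum>e\<in>outer. ?r e) = ?r {a, f} + (?r e2 + ?r e3)"
    unfolding outer using outer_distinct[symmetric] e23(2) by simp
  have pos: "weight E e > 0" if "e \<in> outer" for e using that weight_pos by (simp add: outer_def)
  have r5: "?r e \<ge> 1 / sqrt 5" if "e \<in> outer" "weight E e \<le> 5" for e
    using that pos[of e] by (intro frac_le) auto
  have r6: "?r e \<ge> 1 / sqrt 6" if "e \<in> outer" for e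
    using that weight_outer_bounds(1)[of e] k pos[of e] by (intro frac_le) auto
  have r1: "?r {a, f} \<ge> 1 / sqrt 5"
    using e1 weight_outer_bounds(2)[of "{a, f}"] k by (intro r5) auto
  have in_outer: "e2 \<in> outer" "e3 \<in> outer" using outer by auto
  show ?thesis
  proof (cases "weight E e2 \<ge> 6 \<and> weight E e3 \<ge> 6")
    case True
    have "f \<notin> e2" "f \<notin> e3"
      using True max_weight_outer(1)[of e2] max_weight_outer(1)[of e3] in_outer f k by auto
    moreover have "{a, f} \<inter> e2 \<noteq> {}" "{a, f} \<inter> e3 \<noteq> {}"
      using True max_weight_outer(2)[of e2 "{a, f}"] max_weight_outer(2)[of e3 "{a, f}"] in_outer e1 k by auto
    ultimately have "a \<in> e2" "a \<in> e3" by auto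
    moreover have "e2 \<in> E" "e3 \<in> E" using in_outer by (auto simp: outer_def)
    ultimately obtain x y where xy: "e2 = {a, x}" "x \<noteq> a" "x \<in> V" "e3 = {a, y}" "y \<noteq> a" "y \<in> V"
      using other_endpoint by metis
    have "distinct [c, a, x, y, f]"
      using xy e23(2) \<open>f \<notin> e2\<close> \<open>f \<notin> e3\<close> fV \<open>a \<noteq> c\<close> a outer_subset[OF in_outer(1)] outer_subset[OF in_outer(2)]
      by auto
    moreover have "{c, a, x, y, f} \<subseteq> V" using c_in a fV xy by auto
    moreover have "E = insert {a, x} (insert {a, y} (insert {a, f} (star (V - {c, f}) c)))"
      using E_eq outer xy nbrs by auto
    ultimately have "B4_shape V E"
      unfolding B4_shape_def by (intro exI conjI)
    then show ?thesis ..
  next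
    case False
    then have "?r e2 \<ge> 1 / sqrt 5 \<or> ?r e3 \<ge> 1 / sqrt 5" using r5 in_outer by force
    then have "?r e2 + ?r e3 \<ge> 1 / sqrt 6 + 1 / sqrt 5"
      using r6[OF in_outer(1)] r6[OF in_outer(2)] by linarith
    then show ?thesis using split r1 by simp
  qed
qed

text \<open>
  For \<open>n = 9\<close> Jensen's inequality is used with a perfect square slightly above the bound on the
  mean weight, which keeps the square root rational; the same device serves \<open>n = 6\<close> and \<open>n = 7\<close> below.
\<close>

lemma chi_gt_chi_B3:
  assumes n: "n \<ge> 8" and k: "k \<ge> 1" and max: "\<And>v. v \<in> V \<Longrightarrow> deg E v \<le> deg E c"
  shows "chi E > chi_B3 (real n)"
proof (cases "2 * k + 4 \<le> n")
  case True
  show ?thesis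
    using center_bound[OF n_eq n k True] star_sum_ge[of "real (deg E c) + 1"] outer_sum_ge chi_split
    by simp
next
  case False
  let ?D = "deg E c"
  \<comment> \<open>The failed condition, rewritten through \<open>n_eq\<close> as an upper bound on
    the maximum degree.\<close>
  have D: "2 * (?D + 1) \<le> n + 3" using False n_eq by presburger
  have sq: "(\<Sum>v\<in>V. (deg E v)\<^sup>2) \<le> (?D + 1) * (n + 2) + n"
    using n max by (intro sum_deg_sq_le) auto
  consider "n = 8" | "n = 9" | "n \<ge> 10" using n by linarith
  then show ?thesis
  proof cases
    case 1
    then have "?D + 1 \<le> 5" using D by presburger
    then have "(?D + 1) * (n + 2) \<le> 5 * 10" using 1 by (intro mult_mono) auto
    \<comment> \<open>The sum is at most 58; it is relaxed to 63 = 7 * 9 to match nine edges and the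
      tangent point 7.\<close>
    with sq have "(\<Sum>v\<in>V. (deg E v)\<^sup>2) \<le> 63" using 1 by linarith
    then have "real (\<Sum>v\<in>V. (deg E v)\<^sup>2) \<le> 63" by (metis of_nat_le_iff of_nat_numeral)
    then show ?thesis using chi_ge_jensen[of 7] jensen_bound_8_9(1) 1 by simp
  next
    case 2
    then have "?D + 1 \<le> 6" using D by presburger
    then have "(?D + 1) * (n + 2) \<le> 6 * 11" using 2 by (intro mult_mono) auto
    with sq have "(\<Sum>v\<in>V. (deg E v)\<^sup>2) \<le> 75" using 2 by linarith
    then have "real (\<Sum>v\<in>V. (deg E v)\<^sup>2) \<le> 75" by (metis of_nat_le_iff of_nat_numeral)
    then show ?thesis using chi_ge_jensen[of "121 / 16"] jensen_bound_8_9(2) 2 by simp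
  next
    case 3
    \<comment> \<open>Everything is doubled so that \<open>D\<close> can be inserted without
      division. The resulting bound factors with \<open>n + 1\<close>, the number of edges, which
      explains the mean \<open>(n + 6) / 2\<close>.\<close>
    have "2 * (\<Sum>v\<in>V. (deg E v)\<^sup>2) \<le> 2 * (?D + 1) * (n + 2) + 2 * n" using sq by simp
    also have "\<dots> \<le> (n + 3) * (n + 2) + 2 * n"
      using D by (intro add_right_mono mult_right_mono) auto
    also have "\<dots> = (n + 6) * (n + 1)" by (simp add: algebra_simps)
    finally have "real (2 * (\<Sum>v\<in>V. (deg E v)\<^sup>2)) \<le> real ((n + 6) * (n + 1))"
      by (simp only: of_nat_le_iff)
    then have "real (\<Sum>v\<in>V. (deg E v)\<^sup>2) \<le> (real n + 6) / 2 * (real n + 1)"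
      by (simp add: algebra_simps)
    then have "chi E \<ge> (real n + 1) / sqrt ((real n + 6) / 2)"
      by (intro chi_ge_jensen) auto
    then show ?thesis using jensen_bound[of "real n"] 3 by simp
  qed
qed

end

section \<open>Every bicyclic graph is first, second or strictly larger\<close>

context bicyclic_edges
begin

lemma trichotomy_5:
  assumes "n = 5"
  shows "M_shape V E \<or> P5_shape V E \<or> chi E > 3 / sqrt 6 + 2 / sqrt 5 + 1 / 2"
proof -
  \<comment> \<open>The two competitors are Jensen's bound from \<open>P5_shape_or_chi_ge\<close>
    and the graph \<open>B_{5,3}\<close> from the case \<open>k = 0\<close>.\<close>
  have num: "3 / sqrt 6 + 2 / sqrt 5 + 1 / 2 < 6 / sqrt (5::real)"
    "3 / sqrt 6 + 2 / sqrt 5 + 1 / 2 < chi_B3 5"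
    using sqrt_bounds by (simp_all add: chi_B3_def divide_sqrt)
  have "2 \<le> n" using assms by simp
  then obtain c k where ck: "bicyclic_center V E n c k" and max: "\<And>v. v \<in> V \<Longrightarrow> deg E v \<le> deg E c"
    by (rule exists_max_center) blast
  interpret bicyclic_center V E n c k by fact
  show ?thesis
  proof (cases "k = 0")
    case True
    then show ?thesis using no_far_shape B3_shape_chi[OF finite_V card_V] num(2) assms by auto
  next
    case False
    then have "deg E c \<le> 3" using n_eq assms by linarith
    then have "deg E v \<le> 3" if "v \<in> V" for v using max[OF that] by linarith
    then show ?thesis using P5_shape_or_chi_ge[OF assms] num(1) by force
  qed
qed

lemma trichotomy_6_7:
  assumes n: "n = 6 \<or> n = 7"
  shows "M_shape V E \<or> B4_shape V E \<or> chi E > chi_B4 (real n)"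
proof -
  have "2 \<le> n" using n by auto
  then obtain c k where ck: "bicyclic_center V E n c k"
    and max: "\<And>v. v \<in> V \<Longrightarrow> deg E v \<le> deg E c" and D3: "deg E c \<ge> 3"
    by (rule exists_max_center) blast
  interpret bicyclic_center V E n c k by fact
  have sqrts: "sqrt (25 / 4) = (5 / 2 :: real)" "sqrt (144 / 25) = (12 / 5 :: real)"
    by (rule real_sqrt_unique; simp add: power2_eq_square)+
  have sq: "(\<Sum>v\<in>V. (deg E v)\<^sup>2) \<le> (deg E c + 1) * (n + 2) + n"
    using \<open>2 \<le> n\<close> max by (intro sum_deg_sq_le) auto
  consider "k = 0" | "n = 6" "deg E c = 4" "k = 1" | "n = 7" "deg E c = 5" "k = 1"
    | "n = 7" "deg E c = 4" | "deg E c = 3"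
    using n n_eq D3 by linarith
  then show ?thesis
  proof cases
    case 1
    then show ?thesis using no_far_shape B3_shape_chi[OF finite_V card_V] chi_B4_6_7(1,2) n by auto
  next
    case 2
    \<comment> \<open>The four edges at \<open>c\<close> have total weight at most 4 * 5 + 5 = 25,
      so the tangent is taken at the mean 25/4 and gives 4 / (5/2) = 8/5.\<close>
    then show ?thesis
      using one_far_shape star_sum_ge[of "25 / 4"] chi_split chi_B4_6_7(5) by (auto simp: sqrts)
  next
    case 3
    \<comment> \<open>The five edges at \<open>c\<close> have total weight at most 5 * 6 + 5 = 35,
      so the mean is 7.\<close>
    have "3 * 5 / (2 * sqrt 7) - (5 * (5 + 1) + (1 + 4)) / (2 * 7 * sqrt 7) = 5 / sqrt (7::real)"
      by (simp add: field_simps)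
    then show ?thesis
      using 3 one_far_shape star_sum_ge[of 7] chi_split chi_B4_6_7(6) by auto
  next
    case 4
    then have "(\<Sum>v\<in>V. (deg E v)\<^sup>2) \<le> 50" using max by (intro sum_deg_sq_le_50) auto
    then have "real (\<Sum>v\<in>V. (deg E v)\<^sup>2) \<le> 50" by (metis of_nat_le_iff of_nat_numeral)
    then show ?thesis using chi_ge_jensen[of "25 / 4"] chi_B4_6_7(4) 4 by (simp add: sqrts)
  next
    case 5
    \<comment> \<open>The bound equals 5n + 8, which is 38 or 43; both are below 144/25 times the
      number of edges, 7 or 8.\<close>
    have "real (\<Sum>v\<in>V. (deg E v)\<^sup>2) \<le> real ((deg E c + 1) * (n + 2) + n)"
      using sq by (simp only: of_nat_le_iff)
    then show ?thesis
      using chi_ge_jensen[of "144 / 25"] chi_B4_6_7(3,4) 5 n by (auto simp: sqrts)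
  qed
qed

lemma trichotomy_8:
  assumes n: "n \<ge> 8"
  shows "M_shape V E \<or> B3_shape V E \<or> chi E > chi_B3 (real n)"
proof -
  have "2 \<le> n" using n by auto
  then obtain c k where ck: "bicyclic_center V E n c k" and max: "\<And>v. v \<in> V \<Longrightarrow> deg E v \<le> deg E c"
    by (rule exists_max_center) blast
  interpret bicyclic_center V E n c k by fact
  show ?thesis
    using no_far_shape chi_gt_chi_B3[OF n _ max] by (cases "k = 0") auto
qed

end

section \<open>Order of the two smallest values and the final statement\<close>

definition chi_M :: "real \<Rightarrow> real" where
  "chi_M x = 1 / sqrt (x + 2) + (x - 4) / sqrt x + 2 / sqrt (x + 1) + 2 / sqrt 5"

text \<open>After replacing \<open>x + 2\<close> by \<open>x + 1\<close>, the claim compares the gap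
  between 1 / sqrt x and 1 / sqrt (x + 1) with the constant 1 - 2 / sqrt 5. The tangent bounds the
  gap by 1 / (2 x sqrt x), which is already small enough at \<open>x = 8\<close>.\<close>

lemma chi_M_less_chi_B3:
  assumes "x \<ge> 8"
  shows "chi_M x < chi_B3 x"
proof -
  have "1 / sqrt (x + 1) \<ge> 3 / (2 * sqrt x) - (x + 1) / (2 * x * sqrt x)"
    using assms by (intro inverse_sqrt_tangent) auto
  also have "3 / (2 * sqrt x) - (x + 1) / (2 * x * sqrt x) = 1 / sqrt x - 1 / (2 * x * sqrt x)"
    using assms by (simp add: field_simps)
  finally have 1: "1 / sqrt x - 1 / sqrt (x + 1) \<le> 1 / (2 * x * sqrt x)" by simp
  have "1 / (2 * x * sqrt x) \<le> 1 / (2 * 8 * sqrt 8)"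
    using assms by (intro divide_left_mono mult_mono) auto
  also have "\<dots> < 1 - 2 / sqrt 5"
    using sqrt_bounds by (simp add: divide_sqrt divide_mult_sqrt)
  finally have 2: "1 / sqrt x - 1 / sqrt (x + 1) < 1 - 2 / sqrt 5" using 1 by linarith
  have 3: "1 / sqrt (x + 2) \<le> 1 / sqrt (x + 1)"
    using assms by (intro divide_left_mono) auto
  have 4: "(x - 4) / sqrt x = (x - 5) / sqrt x + 1 / sqrt x"
    by (simp add: add_divide_distrib[symmetric])
  have 5: "4 / sqrt (x + 1) = 4 * (1 / sqrt (x + 1))" "2 / sqrt (x + 1) = 2 * (1 / sqrt (x + 1))"
    by simp_all
  show ?thesis
    unfolding chi_M_def chi_B3_def 4 5 using 2 3 by linarith
qed

lemma chi_M_small: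
  "chi_M 5 < 3 / sqrt 6 + 2 / sqrt 5 + 1 / 2" "chi_M 6 < chi_B4 6" "chi_M 7 < chi_B4 7"
  using sqrt_bounds by (simp_all add: chi_M_def chi_B4_def sqrt_nine divide_sqrt)

text \<open>The last claim separates all graphs other than \<open>M\<close> and \<open>S\<close>
  from \<open>s\<close> strictly. Together with the invariance of the index it yields both minima
  and both uniqueness statements.\<close>

lemma second_extremal:
  fixes n :: nat
  assumes n: "n \<ge> 5"
  defines "M \<equiv> B_graph (n - 1) 3"
    and "S \<equiv> (if n = 5 then attach_pendents K4_minus_e 2 1
              else if n = 6 \<or> n = 7 then B_graph (n - 2) 4
              else B3_graph n)"
    and "s \<equiv> (if n = 5 then 3 / sqrt 6 + 2 / sqrt 5 + 1 / 2
              else if n = 6 \<or> n = 7 then chi_B4 (real n)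
              else chi_B3 (real n))"
  shows "bicyclic n M" "sum_connectivity M = chi_M (real n)"
    and "bicyclic n S" "sum_connectivity S = s" "chi_M (real n) < s"
    and "bicyclic n (G :: 'a pair_pre_digraph) \<Longrightarrow> G \<simeq>\<^sub>g M \<or> G \<simeq>\<^sub>g S \<or> sum_connectivity G > s"
proof -
  have M: "pair_graph M" "pverts M = {0..<n}" "M_shape {0..<n} (uedges M)"
    using M_shape_B_graph[of n] n unfolding M_def by auto
  show "bicyclic n M" using M_shape_bicyclic[of M] M by simp
  show "sum_connectivity M = chi_M (real n)"
    using M_shape_chi[of "{0..<n}" n] M by (simp add: sum_connectivity_eq_chi chi_M_def)
  consider (5) "n = 5" | (67) "n = 6 \<or> n = 7" | (8) "n \<ge> 8" using n by linarith
  then have "bicyclic n S \<and> sum_connectivity S = s \<and> chi_M (real n) < s \<and>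
    (bicyclic n G \<longrightarrow> G \<simeq>\<^sub>g M \<or> G \<simeq>\<^sub>g S \<or> sum_connectivity G > s)"
  proof cases
    case 5
    have s: "s = 3 / sqrt 6 + 2 / sqrt 5 + 1 / 2" using 5 by (simp add: s_def)
    have S: "pair_graph S" "pverts S = {0..<n}" "P5_shape {0..<n} (uedges S)"
      using P5_shape_attach_pendents 5 by (auto simp: S_def)
    have "G \<simeq>\<^sub>g M \<or> G \<simeq>\<^sub>g S \<or> sum_connectivity G > s" if G: "bicyclic n G"
    proof -
      interpret bicyclic_edges "pverts G" "uedges G" n
        using bicyclic_imp_bicyclic_edges[OF G] n by simp
      have pg: "pair_graph G" using G by (simp add: bicyclic_def)
      show ?thesis
        using trichotomy_5[OF 5] M_shape_iso[OF pg M(1)] P5_shape_iso[OF pg S(1)] M S card_V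
        by (auto simp: sum_connectivity_eq_chi[OF pg] s)
    qed
    then show ?thesis
      using P5_shape_bicyclic[of S] P5_shape_chi[OF S(3)] S s 5 chi_M_small(1)
      by (simp add: sum_connectivity_eq_chi)
  next
    case 67
    have s: "s = chi_B4 (real n)" using 67 by (auto simp: s_def)
    have S: "pair_graph S" "pverts S = {0..<n}" "B4_shape {0..<n} (uedges S)"
      using B4_shape_B_graph[of n] 67 by (auto simp: S_def)
    have "G \<simeq>\<^sub>g M \<or> G \<simeq>\<^sub>g S \<or> sum_connectivity G > s" if G: "bicyclic n G"
    proof -
      interpret bicyclic_edges "pverts G" "uedges G" n
        using bicyclic_imp_bicyclic_edges[OF G] n by simp
      have pg: "pair_graph G" using G by (simp add: bicyclic_def)
      show ?thesis
        using trichotomy_6_7[OF 67] M_shape_iso[OF pg M(1)] B4_shape_iso[OF pg S(1)] M S card_V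
        by (auto simp: sum_connectivity_eq_chi[OF pg] s)
    qed
    moreover have "chi_M (real n) < s" using 67 chi_M_small(2,3) s by auto
    moreover have "sum_connectivity S = s"
      using B4_shape_chi[OF _ _ S(3)] by (simp add: sum_connectivity_eq_chi[OF S(1)] s chi_B4_def)
    ultimately show ?thesis using B4_shape_bicyclic[of S] S by simp
  next
    case 8
    have s: "s = chi_B3 (real n)" using 8 by (auto simp: s_def)
    have S: "pair_graph S" "pverts S = {0..<n}" "B3_shape {0..<n} (uedges S)"
      using B3_shape_B3_graph[of n] 8 by (auto simp: S_def)
    have "G \<simeq>\<^sub>g M \<or> G \<simeq>\<^sub>g S \<or> sum_connectivity G > s" if G: "bicyclic n G"
    proof -
      interpret bicyclic_edges "pverts G" "uedges G" n
        using bicyclic_imp_bicyclic_edges[OF G] n by simp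
      have pg: "pair_graph G" using G by (simp add: bicyclic_def)
      show ?thesis
        using trichotomy_8[OF 8] M_shape_iso[OF pg M(1)] B3_shape_iso[OF pg S(1)] M S card_V
        by (auto simp: sum_connectivity_eq_chi[OF pg] s)
    qed
    moreover have "sum_connectivity S = s"
      using B3_shape_chi[OF _ _ S(3)] by (simp add: sum_connectivity_eq_chi[OF S(1)] s)
    ultimately show ?thesis using B3_shape_bicyclic[of S] S chi_M_less_chi_B3[of "real n"] 8 s by simp
  qed
  then show "bicyclic n S" "sum_connectivity S = s" "chi_M (real n) < s"
    "bicyclic n G \<Longrightarrow> G \<simeq>\<^sub>g M \<or> G \<simeq>\<^sub>g S \<or> sum_connectivity G > s"
    by blast+
qed

theorem theorem3:
  fixes n :: nat
  assumes "n \<ge> 5"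
  shows
    "let M = B_graph (n - 1) 3;
         S = (if n = 5 then attach_pendents K4_minus_e 2 1
              else if n = 6 \<or> n = 7 then B_graph (n - 2) 4
              else B3_graph n)
     in bicyclic n M \<and>
        (\<forall>G :: 'a pair_pre_digraph. bicyclic n G \<longrightarrow>
           sum_connectivity M \<le> sum_connectivity G \<and>
           (sum_connectivity G = sum_connectivity M \<longleftrightarrow> G \<simeq>\<^sub>g M)) \<and>
        sum_connectivity M =
          1 / sqrt (real n + 2) + (real n - 4) / sqrt (real n) + 2 / sqrt (real n + 1) + 2 / sqrt 5 \<and>
        bicyclic n S \<and>
        sum_connectivity M < sum_connectivity S \<and>
        (\<forall>G :: 'a pair_pre_digraph. bicyclic n G \<and> \<not> G \<simeq>\<^sub>g M \<longrightarrow>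
           sum_connectivity S \<le> sum_connectivity G \<and>
           (sum_connectivity G = sum_connectivity S \<longleftrightarrow> G \<simeq>\<^sub>g S)) \<and>
        (n = 5 \<longrightarrow> sum_connectivity S = 3 / sqrt 6 + 2 / sqrt 5 + 1 / 2) \<and>
        (n = 6 \<or> n = 7 \<longrightarrow> sum_connectivity S =
          1 / sqrt (real n + 2) + 2 / sqrt (real n) + (real n - 5) / sqrt (real n - 1) +
          2 / sqrt 6 + 1 / sqrt 5) \<and>
        (n \<ge> 8 \<longrightarrow> sum_connectivity S =
          4 / sqrt (real n + 1) + (real n - 5) / sqrt (real n) + 1)"
proof -
  define M where "M = B_graph (n - 1) 3"
  define S where "S = (if n = 5 then attach_pendents K4_minus_e 2 1
    else if n = 6 \<or> n = 7 then B_graph (n - 2) 4 else B3_graph n)"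
  define s where "s = (if n = 5 then 3 / sqrt 6 + 2 / sqrt 5 + 1 / 2
    else if n = 6 \<or> n = 7 then chi_B4 (real n) else chi_B3 (real n))"
  note ext = second_extremal[OF assms, folded M_def S_def s_def]
  \<comment> \<open>Invariance is needed between a graph on an arbitrary vertex type and the
    concrete graphs on natural numbers.\<close>
  have iso: "sum_connectivity G = sum_connectivity H"
    if "bicyclic n G" "bicyclic n H" "G \<simeq>\<^sub>g H"
    for G :: "'a pair_pre_digraph" and H :: "nat pair_pre_digraph"
    using that graph_iso_imp_sum_connectivity_eq by (auto simp: bicyclic_def)
  have less: "sum_connectivity M < sum_connectivity S" using ext by simp
  have min: "sum_connectivity M \<le> sum_connectivity G \<and>
      (sum_connectivity G = sum_connectivity M \<longleftrightarrow> G \<simeq>\<^sub>g M)"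
    if "bicyclic n G" for G :: "'a pair_pre_digraph"
    using ext(6)[OF that] iso[OF that ext(1)] iso[OF that ext(3)] less ext(4) by fastforce
  have second: "sum_connectivity S \<le> sum_connectivity G \<and>
      (sum_connectivity G = sum_connectivity S \<longleftrightarrow> G \<simeq>\<^sub>g S)"
    if "bicyclic n G" "\<not> G \<simeq>\<^sub>g M" for G :: "'a pair_pre_digraph"
    using ext(6)[OF that(1)] iso[OF that(1) ext(3)] that(2) ext(4) by fastforce
  have vals: "n = 5 \<longrightarrow> sum_connectivity S = 3 / sqrt 6 + 2 / sqrt 5 + 1 / 2"
    "n = 6 \<or> n = 7 \<longrightarrow> sum_connectivity S =
          1 / sqrt (real n + 2) + 2 / sqrt (real n) + (real n - 5) / sqrt (real n - 1) +
          2 / sqrt 6 + 1 / sqrt 5"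
    "n \<ge> 8 \<longrightarrow> sum_connectivity S = 4 / sqrt (real n + 1) + (real n - 5) / sqrt (real n) + 1"
    unfolding ext(4) by (auto simp: s_def chi_B4_def chi_B3_def)
  show ?thesis
    unfolding Let_def M_def[symmetric] S_def[symmetric]
    using ext(1,3) less min second vals ext(2)[unfolded chi_M_def] by blast
qed

end
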